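(* Let $k$ be a countable field and let $L$ be a countably generated Lie algebra over $k$. Then there exist a simple Lie algebra $\mathcal{L}$ over $k$ that is generated as a Lie algebra by two elements, and an injective homomorphism of Lie algebras over $k$, $L\to\mathcal{L}$.
   Context: "Countable" and "countably generated" mean: at most countable, respectively generated by an at most countable set. No assumption is made on the characteristic of $k$ or on the dimension of $L$. A Lie algebra is simple if it is not abelian and its only ideals are $0$ and itself. *)

theory Defs
  imports Complex_Main "HOL-Library.Countable_Set" "HOL-Computational_Algebra.Polynomial"
begin

text \<open>
  Lie algebras live on a linear subspace \<open>L\<close> of an ambient vector space, so that \<open>L\<close> can be
  quantified over; \<open>L = UNIV\<close> is the case in which a whole type is a Lie algebra. The values of
  the bracket outside \<open>L\<close> are irrelevant. The bracket is required to satisfy \<open>[x, x] = 0\<close>, not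
  only antisymmetry, since the characteristic may be 2.
\<close>

locale lie_algebra_on = vector_space scale
  for scale :: "'k::field \<Rightarrow> 'a::ab_group_add \<Rightarrow> 'a"  (infixr "*s" 75) +
  fixes L :: "'a set" and bracket :: "'a \<Rightarrow> 'a \<Rightarrow> 'a"
  assumes subspace_L: "subspace L"
    and bracket_closed: "x \<in> L \<Longrightarrow> y \<in> L \<Longrightarrow> bracket x y \<in> L"
    and bracket_add_left:
      "x \<in> L \<Longrightarrow> y \<in> L \<Longrightarrow> z \<in> L \<Longrightarrow> bracket (x + y) z = bracket x z + bracket y z"
    and bracket_add_right:
      "x \<in> L \<Longrightarrow> y \<in> L \<Longrightarrow> z \<in> L \<Longrightarrow> bracket x (y + z) = bracket x y + bracket x z"
    and bracket_scale_left: "x \<in> L \<Longrightarrow> y \<in> L \<Longrightarrow> bracket (c *s x) y = c *s bracket x y"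
    and bracket_scale_right: "x \<in> L \<Longrightarrow> y \<in> L \<Longrightarrow> bracket x (c *s y) = c *s bracket x y"
    and bracket_self: "x \<in> L \<Longrightarrow> bracket x x = 0"
    and jacobi: "x \<in> L \<Longrightarrow> y \<in> L \<Longrightarrow> z \<in> L \<Longrightarrow>
      bracket x (bracket y z) + bracket y (bracket z x) + bracket z (bracket x y) = 0"
begin

definition lie_subalgebra :: "'a set \<Rightarrow> bool" where
  "lie_subalgebra S \<longleftrightarrow> subspace S \<and> S \<subseteq> L \<and> (\<forall>x\<in>S. \<forall>y\<in>S. bracket x y \<in> S)"

definition lie_ideal :: "'a set \<Rightarrow> bool" where
  "lie_ideal I \<longleftrightarrow> subspace I \<and> I \<subseteq> L \<and> (\<forall>x\<in>L. \<forall>y\<in>I. bracket x y \<in> I)"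

definition abelian :: bool where
  "abelian \<longleftrightarrow> (\<forall>x\<in>L. \<forall>y\<in>L. bracket x y = 0)"

definition simple :: bool where
  "simple \<longleftrightarrow> \<not> abelian \<and> (\<forall>I. lie_ideal I \<longrightarrow> I = {0} \<or> I = L)"

definition generated_by :: "'a set \<Rightarrow> bool" where
  "generated_by G \<longleftrightarrow> G \<subseteq> L \<and> lie_subalgebra hull G = L"

definition countably_generated :: bool where
  "countably_generated \<longleftrightarrow> (\<exists>G. countable G \<and> generated_by G)"

end

locale lie_hom_on =
  dom: lie_algebra_on scale1 L1 bracket1 + cod: lie_algebra_on scale2 L2 bracket2
  for scale1 :: "'k::field \<Rightarrow> 'a::ab_group_add \<Rightarrow> 'a" and L1 bracket1
    and scale2 :: "'k \<Rightarrow> 'b::ab_group_add \<Rightarrow> 'b" and L2 bracket2 +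
  fixes f :: "'a \<Rightarrow> 'b"
  assumes hom_closed: "x \<in> L1 \<Longrightarrow> f x \<in> L2"
    and hom_add: "x \<in> L1 \<Longrightarrow> y \<in> L1 \<Longrightarrow> f (x + y) = f x + f y"
    and hom_scale: "x \<in> L1 \<Longrightarrow> f (scale1 c x) = scale2 c (f x)"
    and hom_bracket: "x \<in> L1 \<Longrightarrow> y \<in> L1 \<Longrightarrow> f (bracket1 x y) = bracket2 (f x) (f y)"

text \<open>
  Since one cannot quantify existentially over types, a concrete ambient space is needed for an
  existence statement. A countably generated Lie algebra has countable dimension, hence is
  isomorphic to one carried by a linear subspace of \<open>'k poly\<close> with scalar action \<^const>\<open>smult\<close>.
  Only this vector space structure of \<open>'k poly\<close>, which has dimension \<open>\<aleph>\<^sub>0\<close>, plays a role.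
\<close>

end

theory Submission imports Defs "HOL-Library.Nat_Bijection" begin

text \<open>
  By the Poincare-Birkhoff-Witt theorem \<open>L\<close> acts faithfully on a space \<open>V\<close> of countable dimension.
  On \<open>V\<close> tensored with \<open>k[t]\<close> each \<open>x\<close> in \<open>L\<close> is the commutator of \<open>d/dt\<close> and \<open>t x\<close>, and if
  \<open>x \<noteq> 0\<close> then its rank is infinite, so that \<open>p x q = 1\<close> for some operators \<open>p\<close>, \<open>q\<close>. All these countably
  many operators lie in an associative algebra \<open>C\<close> generated by two operators \<open>f\<close>, \<open>g\<close>.

  Two 3 by 3 matrices with entries \<open>0, 1, f, g\<close> generate a Lie algebra \<open>S\<close>. The words \<open>w\<close> in
  \<open>f\<close> and \<open>g\<close> enter \<open>S\<close> paired with their reversals. Since some word generates the unit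
  ideal of \<open>C\<close> while its reversal is 0, the pairs can be separated, and \<open>S\<close> contains the
  matrix units \<open>E 1 2 c\<close> and \<open>E 2 1 c\<close> for all \<open>c\<close> in \<open>C\<close>, hence also \<open>E 1 1 x\<close> for \<open>x\<close>
  in \<open>L\<close>. An ideal of \<open>S\<close> containing \<open>E 1 1 x\<close> with \<open>x \<noteq> 0\<close> contains \<open>E 1 2 1\<close>, and then it is
  all of \<open>S\<close>. Dividing \<open>S\<close> by an ideal that is maximal among those avoiding \<open>E 1 2 1\<close> gives the
  simple algebra.
\<close>

section \<open>Column-finite matrices\<close>

text \<open>The linear endomorphism of \<open>'k poly\<close> that sends the monomial of degree
  \<open>i\<close> to \<open>F i\<close>.\<close>

definition lin :: "(nat \<Rightarrow> 'k::comm_ring_1 poly) \<Rightarrow> 'k poly \<Rightarrow> 'k poly" where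
  "lin F p = (\<Sum>i\<le>degree p. smult (coeff p i) (F i))"

lemma lin_eq: "degree p \<le> n \<Longrightarrow> lin F p = (\<Sum>i\<le>n. smult (coeff p i) (F i))"
  unfolding lin_def by (rule sum.mono_neutral_left) (auto simp: coeff_eq_0)

lemma lin_add: "lin F (p + q) = lin F p + lin F q"
proof -
  let ?n = "max (degree p) (degree q)"
  have "degree (p + q) \<le> ?n" by (rule degree_add_le_max)
  then show ?thesis
    by (simp add: lin_eq[of _ ?n] smult_add_left sum.distrib)
qed

lemma smult_sum_right: "smult c (\<Sum>i\<in>A. F i) = (\<Sum>i\<in>A. smult c (F i))"
  by (induction A rule: infinite_finite_induct) (auto simp: smult_add_right)

lemma lin_smult: "lin F (smult c p) = smult c (lin F p)"
proof -
  have "lin F (smult c p) = (\<Sum>i\<le>degree p. smult (coeff (smult c p) i) (F i))"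
    by (rule lin_eq) (rule degree_smult_le)
  also have "\<dots> = smult c (lin F p)"
    by (simp add: lin_def smult_sum_right)
  finally show ?thesis .
qed

lemma lin_0 [simp]: "lin F 0 = 0"
  by (simp add: lin_def)

lemma lin_minus: "lin F (- p) = - lin F p"
  using lin_add[of F p "- p"] by (simp add: eq_neg_iff_add_eq_0 add.commute)

lemma lin_diff: "lin F (p - q) = lin F p - lin F q"
  using lin_add[of F p "- q"] by (simp add: lin_minus)

lemma lin_sum: "lin F (\<Sum>i\<in>A. G i) = (\<Sum>i\<in>A. lin F (G i))"
  by (induction A rule: infinite_finite_induct) (auto simp: lin_add)

lemma lin_monom: "lin F (monom c n) = smult c (F n)"
proof -
  have "lin F (monom c n) = (\<Sum>i\<le>n. smult (coeff (monom c n) i) (F i))"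
    by (rule lin_eq) (rule degree_monom_le)
  also have "\<dots> = (\<Sum>i\<in>{n}. smult (coeff (monom c n) i) (F i))"
    by (rule sum.mono_neutral_right) auto
  finally show ?thesis by simp
qed

lemma lin_lin: "lin F (lin G p) = lin (\<lambda>i. lin F (G i)) p"
  by (simp add: lin_def[of G] lin_def[of "\<lambda>i. lin F (G i)"] lin_sum lin_smult)

lemma lin_monom_id: "lin (monom 1) p = p"
  by (simp add: lin_def smult_monom poly_as_sum_of_monoms)

lemma lin_fun_add: "lin (\<lambda>i. F i + G i) p = lin F p + lin G p"
  by (simp add: lin_def smult_add_right sum.distrib)

lemma lin_fun_diff: "lin (\<lambda>i. F i - G i) p = lin F p - lin G p"
  by (simp add: lin_def smult_diff_right sum_subtractf)

lemma lin_fun_smult: "lin (\<lambda>i. smult c (F i)) p = smult c (lin F p)"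
  by (simp add: lin_def smult_sum_right mult.commute)

lemma lin_fun_0 [simp]: "lin (\<lambda>i. 0) p = 0"
  by (simp add: lin_def)

lemma additive_eq_lin:
  assumes "\<And>p q. h (p + q) = h p + h q" and "\<And>c p. h (smult c p) = smult c (h p)"
  shows "h p = lin (\<lambda>i. h (monom 1 i)) p"
proof -
  have 0: "h 0 = 0" using assms(1)[of 0 0] by simp
  have sum: "h (\<Sum>i\<in>A. G i) = (\<Sum>i\<in>A. h (G i))" for A :: "nat set" and G
    by (induction A rule: infinite_finite_induct) (auto simp: 0 assms(1))
  have "h p = h (\<Sum>i\<le>degree p. smult (coeff p i) (monom 1 i))"
    by (simp add: smult_monom poly_as_sum_of_monoms)
  then show ?thesis by (simp only: sum assms(2) lin_def)
qed

text \<open>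
  Since the monomials form a basis, a sequence of polynomials (the columns) is the same thing as
  an endomorphism of the vector space \<open>'k poly\<close>. No finiteness condition on the rows is needed.
\<close>

typedef (overloaded) 'k endo = "UNIV :: (nat \<Rightarrow> 'k::comm_ring_1 poly) set"
  morphisms col mat ..

setup_lifting type_definition_endo

lemma col_mat [simp]: "col (mat F) n = F n"
  by (simp add: mat_inverse)

lemma endo_eqI: "(\<And>n. col a n = col b n) \<Longrightarrow> a = b"
  by (metis col_inverse ext)

instantiation endo :: (comm_ring_1) ring_1
begin

lift_definition zero_endo :: "'a endo" is "\<lambda>n. 0" .
lift_definition one_endo :: "'a endo" is "\<lambda>n. monom 1 n" .
lift_definition plus_endo :: "'a endo \<Rightarrow> 'a endo \<Rightarrow> 'a endo" is "\<lambda>F G n. F n + G n" .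
lift_definition minus_endo :: "'a endo \<Rightarrow> 'a endo \<Rightarrow> 'a endo" is "\<lambda>F G n. F n - G n" .
lift_definition uminus_endo :: "'a endo \<Rightarrow> 'a endo" is "\<lambda>F n. - F n" .
lift_definition times_endo :: "'a endo \<Rightarrow> 'a endo \<Rightarrow> 'a endo" is "\<lambda>F G n. lin F (G n)" .

instance
proof
  fix a b c :: "'a endo"
  show "a * b * c = a * (b * c)" by transfer (simp add: lin_lin)
  show "1 * a = a" by transfer (simp add: lin_monom_id)
  show "a * 1 = a" by transfer (simp add: lin_monom)
  show "(a + b) * c = a * c + b * c" by transfer (simp add: lin_fun_add)
  show "a * (b + c) = a * b + a * c" by transfer (simp add: lin_add)
  show "(0::'a endo) \<noteq> 1" by transfer (auto simp: fun_eq_iff)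
qed (transfer; simp add: algebra_simps)+

end

lift_definition scaleE :: "'k::comm_ring_1 \<Rightarrow> 'k endo \<Rightarrow> 'k endo" is "\<lambda>c F n. smult c (F n)" .

lemma col_simps:
  "col 0 n = 0" "col 1 n = monom 1 n" "col (a + b) n = col a n + col b n"
  "col (a - b) n = col a n - col b n" "col (a * b) n = lin (col a) (col b n)"
  "col (scaleE c a) n = smult c (col a n)"
  by (transfer; simp)+

lemma scaleE_mult: "scaleE c a * b = scaleE c (a * b)" "a * scaleE c b = scaleE c (a * b)"
  by (transfer; simp add: lin_smult lin_fun_smult)+

lemma vector_space_scaleE: "vector_space (scaleE :: 'k::field \<Rightarrow> _)"
  by unfold_locales (transfer; simp add: smult_add_right smult_add_left)+

section \<open>A two-generated Lie algebra of 3 by 3 matrices\<close>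

definition commutator :: "'r::ring \<Rightarrow> 'r \<Rightarrow> 'r" where
  "commutator x y = x * y - y * x"

locale assoc_algebra = vector_space scale
  for scale :: "'k::field \<Rightarrow> 'r::ring_1 \<Rightarrow> 'r" +
  assumes scale_mult_left: "scale c x * y = scale c (x * y)"
    and scale_mult_right: "x * scale c y = scale c (x * y)"
begin

lemma lie_commutator: "lie_algebra_on scale UNIV commutator"
  by unfold_locales
    (auto simp: commutator_def algebra_simps scale_mult_left scale_mult_right scale_right_diff_distrib)

end

section \<open>The subalgebra generated by two elements\<close>

locale two_letter_algebra = assoc_algebra scale
  for scale :: "'k::field \<Rightarrow> 'r::ring_1 \<Rightarrow> 'r" +
  fixes f g :: 'r
begin

primrec ev :: "bool list \<Rightarrow> 'r" where
  "ev [] = 1"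
| "ev (x # w) = (if x then f else g) * ev w"

text \<open>Products of words are words, so this span is the unital subalgebra generated by
  \<open>f\<close> and \<open>g\<close>.\<close>

definition C :: "'r set" where
  "C = span (range ev)"

lemma ev_append: "ev (v @ w) = ev v * ev w"
  by (induction v) (auto simp: mult.assoc)

lemma ev_in_C: "ev w \<in> C"
  unfolding C_def by (rule span_base) auto

lemma C_1: "1 \<in> C" and C_f: "f \<in> C" and C_g: "g \<in> C"
  using ev_in_C[of "[]"] ev_in_C[of "[True]"] ev_in_C[of "[False]"] by auto

lemma C_add: "x \<in> C \<Longrightarrow> y \<in> C \<Longrightarrow> x + y \<in> C"
  and C_diff: "x \<in> C \<Longrightarrow> y \<in> C \<Longrightarrow> x - y \<in> C"
  unfolding C_def by (auto intro: span_add span_diff)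

text \<open>Besides closure under products, this carries facts about words to maps such as
  \<open>E 1 3 (x * p * y)\<close>, and so to the two-sided ideal generated by a fixed
  \<open>p\<close>.\<close>

lemma C_bilinear_induct:
  assumes "x \<in> C" "y \<in> C"
    and words: "\<And>v w. h (ev v) (ev w) \<in> T"
    and T: "subspace T"
    and left: "\<And>x x' y. h (x + x') y = h x y + h x' y" "\<And>c x y. h (scale c x) y = scale c (h x y)"
    and right: "\<And>x y y'. h x (y + y') = h x y + h x y'" "\<And>c x y. h x (scale c y) = scale c (h x y)"
  shows "h x y \<in> T"
proof -
  have 0: "h 0 z = 0" "h z 0 = 0" for z
    using left(1)[of 0 0 z] right(1)[of z 0 0] by auto
  have 1: "h (ev v) y \<in> T" for v
    using assms(2) unfolding C_def
  proof (induction rule: span_induct)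
    case base
    show ?case
      unfolding mem_Collect_eq subspace_def
      using T by (auto simp: 0 right subspace_def)
  qed (auto intro: words)
  show ?thesis
    using assms(1) unfolding C_def
  proof (induction rule: span_induct)
    case base
    show ?case
      unfolding mem_Collect_eq subspace_def
      using T by (auto simp: 0 left subspace_def)
  qed (auto intro: 1)
qed

lemma C_mult:
  assumes "x \<in> C" "y \<in> C" shows "x * y \<in> C"
  using assms
proof (rule C_bilinear_induct)
  show "subspace C" unfolding C_def by (rule subspace_span)
qed (auto simp: ev_in_C algebra_simps scale_mult_left scale_mult_right simp flip: ev_append)

lemmas C_intros = C_1 C_f C_g C_add C_diff C_mult

end

section \<open>Matrix units inside an algebra, and two generating matrices\<close>

locale matrix_generators = two_letter_algebra scale f g
  for scale :: "'k::field \<Rightarrow> 'r::ring_1 \<Rightarrow> 'r" and f g +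
  fixes \<iota> \<pi> :: "nat \<Rightarrow> 'r" and a b :: 'r
  assumes \<pi>_\<iota>: "\<pi> m * \<iota> n = (if m = n then 1 else 0)"
    and word_0: "g * f * g * f * f = 0"
    and a_in_C: "a \<in> C" and b_in_C: "b \<in> C"
    and rev_word_full: "b * f * f * g * f * g * a = 1"
begin

text \<open>By \<open>\<pi>_\<iota>\<close> the elements \<open>\<iota> m\<close> and
  \<open>\<pi> n\<close> embed and project copies of the algebra inside itself, so matrices over the
  algebra are again elements of it.\<close>

definition E :: "nat \<Rightarrow> nat \<Rightarrow> 'r \<Rightarrow> 'r" where
  "E m n x = \<iota> m * x * \<pi> n"

lemma E_mult: "E m n x * E m' n' y = (if n = m' then E m n' (x * y) else 0)"
proof -
  have "E m n x * E m' n' y = \<iota> m * x * (\<pi> n * \<iota> m') * y * \<pi> n'"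
    by (simp only: E_def mult.assoc)
  then show ?thesis by (simp add: \<pi>_\<iota> E_def mult.assoc)
qed

lemma E_add: "E m n (x + y) = E m n x + E m n y"
  and E_diff: "E m n (x - y) = E m n x - E m n y"
  and E_scale: "E m n (scale c x) = scale c (E m n x)"
  and E_0 [simp]: "E m n 0 = 0"
  by (simp_all add: E_def algebra_simps scale_mult_left scale_mult_right)

lemma E_commutator: "E m m (commutator x y) = commutator (E m m x) (E m m y)"
  by (simp add: commutator_def E_diff E_mult)

lemma E_eq_0_iff: "E m n x = 0 \<longleftrightarrow> x = 0"
proof
  assume "E m n x = 0"
  moreover have "\<pi> m * E m n x * \<iota> n = (\<pi> m * \<iota> m) * x * (\<pi> n * \<iota> n)"
    by (simp only: E_def mult.assoc)
  ultimately show "x = 0" by (simp add: \<pi>_\<iota>)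
qed simp

text \<open>
  \<open>gen1\<close> and its double commutator with \<open>gen2\<close> separate the idempotent in position (2, 2) from
  the rest of \<open>gen2\<close>, in every characteristic. Multiplying the entries around the cycles
  1 - 2 - 1 and 1 - 3 - 1 gives \<open>f\<close> and \<open>g\<close>; the matrices \<open>Z2 w\<close> and \<open>Z3 w\<close> below run through such
  cycles along the word \<open>w\<close> in both directions.
\<close>

definition gen1 :: 'r where "gen1 = E 1 1 1"

definition gen2 :: 'r where "gen2 = E 2 2 1 + E 1 2 f + E 2 1 1 + E 1 3 1 + E 3 1 g"

definition Z2 :: "bool list \<Rightarrow> 'r" where
  "Z2 w = E 1 2 (ev w * f) + E 2 1 (ev (rev w))"

definition Z3 :: "bool list \<Rightarrow> 'r" where
  "Z3 w = E 1 3 (ev w) + E 3 1 (g * ev (rev w))"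

text \<open>The inner commutator sits in positions (2, 3) and (3, 2); the outer one returns to (1,
  3) and (3, 1) and joins the words around a new \<open>f\<close>. The signs cancel.\<close>

lemma commutator_Z3: "commutator (commutator (Z3 c) (Z2 d)) (Z2 d') = Z3 (d' @ True # rev d @ c)"
  by (simp add: commutator_def Z2_def Z3_def algebra_simps E_mult ev_append)

lemma commutator_Z2: "commutator (Z3 c') (commutator (Z3 c) (Z2 d)) = Z2 (c' @ False # rev c @ d)"
  by (simp add: commutator_def Z2_def Z3_def algebra_simps E_mult ev_append)

end

section \<open>Isolating matrix units\<close>

locale matrix_subalgebra = matrix_generators scale f g \<iota> \<pi> a b
  for scale :: "'k::field \<Rightarrow> 'r::ring_1 \<Rightarrow> 'r" and f g \<iota> \<pi> a b +
  fixes S :: "'r set"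
  assumes S_subspace: "subspace S"
    and S_comm: "x \<in> S \<Longrightarrow> y \<in> S \<Longrightarrow> commutator x y \<in> S"
    and S_gens: "gen1 \<in> S" "gen2 \<in> S"
begin

lemma S_diff: "x \<in> S \<Longrightarrow> y \<in> S \<Longrightarrow> x - y \<in> S"
  using S_subspace by (rule subspace_diff)

lemma Z_Nil_in_S: "Z2 [] \<in> S" "Z3 [] \<in> S"
proof -
  define z where "z = commutator gen1 (commutator gen1 gen2)"
  have z: "z = E 1 2 f + E 2 1 1 + E 1 3 1 + E 3 1 g"
    by (simp add: z_def commutator_def gen1_def gen2_def algebra_simps E_mult)
  have zS: "z \<in> S" unfolding z_def by (intro S_comm S_gens)
  \<comment> \<open>The difference is \<open>E 2 2 1\<close>. Commuting with it twice keeps exactly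
    the entries of \<open>z\<close> with one index 2, with their signs.\<close>
  then have "gen2 - z \<in> S" by (intro S_diff S_gens)
  then have "commutator (gen2 - z) (commutator (gen2 - z) z) \<in> S"
    by (intro S_comm zS)
  also have "commutator (gen2 - z) (commutator (gen2 - z) z) = Z2 []"
    by (simp add: z commutator_def gen2_def Z2_def algebra_simps E_mult)
  finally show Z2: "Z2 [] \<in> S" .
  have "z - Z2 [] \<in> S" by (intro S_diff zS Z2)
  also have "z - Z2 [] = Z3 []"
    by (simp add: z Z2_def Z3_def)
  finally show "Z3 [] \<in> S" .
qed

text \<open>The commutator formula for \<open>Z3\<close> inserts a \<open>True\<close>, the one for
  \<open>Z2\<close> a \<open>False\<close>; hence the two conditions. In the induction
  \<open>w\<close> is cut at the first such letter. The prefix lacks that letter and so falls under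
  the other family; the suffix is used directly, or reversed as a member of the other
  family.\<close>

lemma Z_in_S: "(w = [] \<or> True \<in> set w \<longrightarrow> Z3 w \<in> S) \<and> (w = [] \<or> False \<in> set w \<longrightarrow> Z2 w \<in> S)"
proof (induction "length w" arbitrary: w rule: less_induct)
  case less
  have bool_set: "True \<in> set v \<or> False \<in> set v \<or> v = []" for v :: "bool list"
    by (cases v) auto
  have 3: "Z3 w \<in> S" if T: "True \<in> set w"
  proof -
    obtain w1 w2 where w: "w = w1 @ True # w2" "True \<notin> set w1"
      using split_list_first[OF T] by blast
    have w1: "Z2 w1 \<in> S" using less[of w1] w bool_set[of w1] by auto
    show ?thesis
    proof (cases "True \<in> set w2 \<or> w2 = []")
      case True
      then have "Z3 w2 \<in> S" using less[of w2] w by auto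
      then have "Z3 (w1 @ True # rev [] @ w2) \<in> S"
        using w1 unfolding commutator_Z3[symmetric] by (intro S_comm Z_Nil_in_S)
      then show ?thesis using w by simp
    next
      case False
      then have "Z2 (rev w2) \<in> S" using less[of "rev w2"] w bool_set[of w2] by auto
      then have "Z3 (w1 @ True # rev (rev w2) @ []) \<in> S"
        using w1 unfolding commutator_Z3[symmetric] by (intro S_comm Z_Nil_in_S)
      then show ?thesis using w by simp
    qed
  qed
  have 2: "Z2 w \<in> S" if F: "False \<in> set w"
  proof -
    obtain w1 w2 where w: "w = w1 @ False # w2" "False \<notin> set w1"
      using split_list_first[OF F] by blast
    have w1: "Z3 w1 \<in> S" using less[of w1] w bool_set[of w1] by auto
    show ?thesis
    proof (cases "False \<in> set w2 \<or> w2 = []")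
      case True
      then have "Z2 w2 \<in> S" using less[of w2] w by auto
      then have "Z2 (w1 @ False # rev [] @ w2) \<in> S"
        using w1 unfolding commutator_Z2[symmetric] by (intro S_comm Z_Nil_in_S)
      then show ?thesis using w by simp
    next
      case False
      then have "Z3 (rev w2) \<in> S" using less[of "rev w2"] w bool_set[of w2] by auto
      then have "Z2 (w1 @ False # rev (rev w2) @ []) \<in> S"
        using w1 unfolding commutator_Z2[symmetric] by (intro S_comm Z_Nil_in_S)
      then show ?thesis using w by simp
    qed
  qed
  from 2 3 Z_Nil_in_S show ?case by auto
qed

text \<open>
  The word \<open>f f g f g\<close> generates the unit ideal of \<open>C\<close>, but its reversal vanishes. This asymmetry
  splits the two summands of \<open>Z2 w\<close> and of \<open>Z3 w\<close>.
\<close>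

lemma E13_word: "E 1 3 (ev v * (f * f * g * f * g) * ev w) \<in> S"
  and E12_word: "E 1 2 (ev v * (f * f * g * f * g) * ev w * f) \<in> S"
proof -
  let ?p = "[True, True, False, True, False]"
  let ?w = "v @ ?p @ w"
  have "ev (rev ?w) = ev (rev w) * (g * f * g * f * f) * ev (rev v)"
    by (simp add: ev_append mult.assoc)
  then have "ev (rev ?w) = 0" by (simp only: word_0) simp
  moreover have "ev ?w = ev v * (f * f * g * f * g) * ev w"
    by (simp add: ev_append mult.assoc)
  moreover have "Z3 ?w \<in> S" "Z2 ?w \<in> S" using Z_in_S[of ?w] by auto
  ultimately show "E 1 3 (ev v * (f * f * g * f * g) * ev w) \<in> S"
    and "E 1 2 (ev v * (f * f * g * f * g) * ev w * f) \<in> S"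
    by (simp_all only: Z2_def Z3_def) simp_all
qed

text \<open>In \<open>x * (f * f * g * f * g) * y\<close> with \<open>x = c * b\<close> and
  \<open>y = a\<close>, \<open>rev_word_full\<close> leaves just \<open>c\<close>.\<close>

lemma E13_in_S: assumes "c \<in> C" shows "E 1 3 c \<in> S"
proof -
  have "E 1 3 ((c * b) * (f * f * g * f * g) * a) \<in> S"
  proof (rule C_bilinear_induct[where T = S and h = "\<lambda>x y. E 1 3 (x * (f * f * g * f * g) * y)"])
    show "E 1 3 (ev v * (f * f * g * f * g) * ev w) \<in> S" for v w by (rule E13_word)
  qed (auto intro!: S_subspace assms a_in_C b_in_C C_intros
      simp: algebra_simps E_add E_scale scale_mult_left scale_mult_right)
  also have "(c * b) * (f * f * g * f * g) * a = c * (b * f * f * g * f * g * a)"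
    by (simp only: mult.assoc)
  finally show ?thesis by (simp add: rev_word_full)
qed

text \<open>As for \<open>E13_in_S\<close>, except that a right factor \<open>f\<close> remains
  until a left inverse of \<open>f\<close> is at hand.\<close>

lemma E12f_in_S: assumes "c \<in> C" shows "E 1 2 (c * f) \<in> S"
proof -
  have "E 1 2 ((c * b) * (f * f * g * f * g) * a * f) \<in> S"
  proof (rule C_bilinear_induct[where T = S and h = "\<lambda>x y. E 1 2 (x * (f * f * g * f * g) * y * f)"])
    show "E 1 2 (ev v * (f * f * g * f * g) * ev w * f) \<in> S" for v w by (rule E12_word)
  qed (auto intro!: S_subspace assms a_in_C b_in_C C_intros
      simp: algebra_simps E_add E_scale scale_mult_left scale_mult_right)
  also have "(c * b) * (f * f * g * f * g) * a * f = c * (b * f * f * g * f * g * a) * f"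
    by (simp only: mult.assoc)
  finally show ?thesis by (simp add: rev_word_full)
qed

lemma E21_1_in_S: "E 2 1 1 \<in> S" and E31_g_in_S: "E 3 1 g \<in> S"
proof -
  have "Z2 [] - E 1 2 (1 * f) \<in> S" "Z3 [] - E 1 3 1 \<in> S"
    by (intro S_diff Z_Nil_in_S E12f_in_S E13_in_S C_1)+
  then show "E 2 1 1 \<in> S" "E 3 1 g \<in> S" by (simp_all add: Z2_def Z3_def)
qed

lemma E23_in_S: assumes "c \<in> C" shows "E 2 3 c \<in> S"
  using S_comm[OF E21_1_in_S E13_in_S[OF assms]] by (simp add: commutator_def E_mult)

end

text \<open>\<open>k\<close> removes the factor \<open>f\<close> left in \<open>E12f_in_S\<close>.
  As 1 is a commutator of \<open>s\<close> and \<open>t\<close>, commutators within an ideal can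
  produce \<open>E 1 1 1\<close>.\<close>

locale simple_cover = matrix_subalgebra scale f g \<iota> \<pi> a b S
  for scale :: "'k::field \<Rightarrow> 'r::ring_1 \<Rightarrow> 'r" and f g \<iota> \<pi> a b S +
  fixes k s t
  assumes k_in_C: "k \<in> C" and k_f: "k * f = 1"
    and s_in_C: "s \<in> C" and t_in_C: "t \<in> C" and commutator_s_t: "commutator s t = 1"
begin

lemma E12_in_S: assumes "c \<in> C" shows "E 1 2 c \<in> S"
  using E12f_in_S[of "c * k"] assms k_in_C by (simp add: mult.assoc k_f C_mult)

lemma E32_in_S: assumes "c \<in> C" shows "E 3 2 (g * c) \<in> S"
  using S_comm[OF E31_g_in_S E12_in_S[OF assms]] by (simp add: commutator_def E_mult)

lemma E31_in_S: assumes "c \<in> C" shows "E 3 1 (g * c) \<in> S"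
  using S_comm[OF E32_in_S[OF assms] E21_1_in_S] by (simp add: commutator_def E_mult)

text \<open>The lemmas on row 3 give only entries in \<open>g * C\<close>. Since 1 lies in the
  two-sided ideal of \<open>g\<close>, a path through index 3 still yields every entry: the first
  factor goes into column 3, \<open>g * a\<close> into row 3.\<close>

lemma factor_through_g: "c = (c * b * f * f * g * f) * (g * a)"
proof -
  have "(c * b * f * f * g * f) * (g * a) = c * (b * f * f * g * f * g * a)"
    by (simp only: mult.assoc)
  then show ?thesis by (simp add: rev_word_full)
qed

lemma E21_in_S: assumes "c \<in> C" shows "E 2 1 c \<in> S"
proof -
  have "c * b * f * f * g * f \<in> C" using assms b_in_C by (intro C_intros)
  from S_comm[OF E23_in_S[OF this] E31_in_S[OF a_in_C]] show ?thesis
    by (simp add: commutator_def E_mult flip: factor_through_g)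
qed

text \<open>The commutator of \<open>E 1 2 c\<close> and \<open>E 2 1 d\<close> has diagonal entries
  \<open>c * d\<close> and \<open>- (d * c)\<close>. Subtracting the same expression for
  \<open>1\<close> and \<open>d * c\<close> cancels position (2, 2).\<close>

lemma E11_commutator_in_S:
  assumes "c \<in> C" "d \<in> C" shows "E 1 1 (commutator c d) \<in> S"
proof -
  have "commutator (E 1 2 c) (E 2 1 d) - commutator (E 1 2 1) (E 2 1 (d * c)) \<in> S"
    using assms by (intro S_diff S_comm E12_in_S E21_in_S C_intros)
  then show ?thesis by (simp add: commutator_def E_mult E_diff)
qed

text \<open>From \<open>E 1 2 1\<close> the ideal spreads to positions (3, 2), (1, 3), (1, 2), (3,
  1), (2, 1) and then to the diagonal. If the two generators generate \<open>S\<close>, such an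
  ideal is all of \<open>S\<close>.\<close>

lemma generators_in_ideal:
  assumes I: "subspace I" "I \<subseteq> S" and ideal: "\<And>x y. x \<in> S \<Longrightarrow> y \<in> I \<Longrightarrow> commutator x y \<in> I"
    and E12: "E 1 2 1 \<in> I"
  shows "gen1 \<in> I" "gen2 \<in> I"
proof -
  have I_diff: "x - y \<in> I" if "x \<in> I" "y \<in> I" for x y using that I by (auto intro: subspace_diff)
  have I_add: "x + y \<in> I" if "x \<in> I" "y \<in> I" for x y using that I by (auto intro: subspace_add)
  have ideal': "commutator y x \<in> I" if "x \<in> S" "y \<in> I" for x y
    using subspace_neg[OF I(1) ideal[OF that]] by (simp add: commutator_def)
  have E32: "E 3 2 (g * c) \<in> I" if "c \<in> C" for c
    using ideal[OF E31_in_S[OF that] E12] by (simp add: commutator_def E_mult)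
  have E13: "E 1 3 c \<in> I" if "c \<in> C" for c
    using ideal'[OF E23_in_S[OF that] E12] by (simp add: commutator_def E_mult)
  have E12c: "E 1 2 c \<in> I" if "c \<in> C" for c
  proof -
    have "c * b * f * f * g * f \<in> C" using that b_in_C by (intro C_intros)
    from ideal'[OF E32_in_S[OF a_in_C] E13[OF this]] show ?thesis
      by (simp add: commutator_def E_mult flip: factor_through_g)
  qed
  have E31: "E 3 1 (g * c) \<in> I" if "c \<in> C" for c
    using ideal'[OF E21_1_in_S E32[OF that]] by (simp add: commutator_def E_mult)
  have E21: "E 2 1 c \<in> I" if "c \<in> C" for c
  proof -
    have "c * b * f * f * g * f \<in> C" using that b_in_C by (intro C_intros)
    from ideal[OF E23_in_S[OF this] E31[OF a_in_C]] show ?thesis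
      by (simp add: commutator_def E_mult flip: factor_through_g)
  qed
  \<comment> \<open>The cancellation of \<open>E11_commutator_in_S\<close>, now inside
    \<open>I\<close>.\<close>
  have "commutator (E 1 2 s) (E 2 1 t) - commutator (E 1 2 1) (E 2 1 (t * s)) \<in> I"
    by (intro I_diff ideal' E12 E12c E21_in_S s_in_C t_in_C C_mult)
  moreover have "commutator (E 1 2 s) (E 2 1 t) - commutator (E 1 2 1) (E 2 1 (t * s))
      = E 1 1 (commutator s t)"
    by (simp add: commutator_def E_mult E_diff)
  ultimately have E11: "E 1 1 1 \<in> I" by (simp add: commutator_s_t)
  then show "gen1 \<in> I" by (simp add: gen1_def)
  have "E 1 1 1 - commutator (E 1 2 1) (E 2 1 1) \<in> I"
    by (intro I_diff E11 ideal' E12 E21_in_S C_1)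
  then have "E 2 2 1 \<in> I" by (simp add: commutator_def E_mult)
  then have "E 2 2 1 + E 1 2 f + E 2 1 1 + E 1 3 1 + E 3 1 (g * 1) \<in> I"
    by (intro I_add E12c E21 E13 E31 C_1 C_f)
  then show "gen2 \<in> I" by (simp add: gen2_def)
qed

text \<open>Commuting with \<open>E 1 2 q\<close> multiplies by \<open>q\<close> on the right, up to
  sign. Multiplication by \<open>p\<close> on the left goes through position (3, 2), with
  \<open>p\<close> split by \<open>factor_through_g\<close>.\<close>

lemma E12_1_in_ideal:
  assumes I: "subspace I" "I \<subseteq> S" and ideal: "\<And>x y. x \<in> S \<Longrightarrow> y \<in> I \<Longrightarrow> commutator x y \<in> I"
    and x: "E 1 1 x \<in> I" and p: "p \<in> C" "q \<in> C" "p * x * q = 1"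
  shows "E 1 2 1 \<in> I"
proof -
  have "commutator (E 1 2 q) (E 1 1 x) \<in> I" by (intro ideal x E12_in_S p)
  then have "- E 1 2 (x * q) \<in> I" by (simp add: commutator_def E_mult)
  then have 1: "E 1 2 (x * q) \<in> I" using subspace_neg[OF I(1)] by fastforce
  have "commutator (E 3 1 (g * a)) (E 1 2 (x * q)) \<in> I" by (intro ideal 1 E31_in_S a_in_C)
  then have 2: "E 3 2 (g * a * (x * q)) \<in> I" by (simp add: commutator_def E_mult)
  have a': "E 1 3 (p * b * f * f * g * f) \<in> S"
    using p b_in_C by (intro E13_in_S C_intros)
  have "commutator (E 1 3 (p * b * f * f * g * f)) (E 3 2 (g * a * (x * q))) \<in> I"
    by (rule ideal[OF a' 2])
  also have "commutator (E 1 3 (p * b * f * f * g * f)) (E 3 2 (g * a * (x * q))) =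
      E 1 2 ((p * b * f * f * g * f) * (g * a) * (x * q))"
    by (simp add: commutator_def E_mult mult.assoc)
  also have "\<dots> = E 1 2 (p * x * q)"
    unfolding factor_through_g[of p, symmetric] by (simp only: mult.assoc)
  finally show ?thesis by (simp add: p)
qed

end

section \<open>Faithful representations\<close>

text \<open>
  The sorted words in the monomials, the basis of the Lie algebra, span the representation space.
  Words are coded as exponents; unsorted words are junk on which the Lie algebra acts by zero.
\<close>

definition word :: "nat list \<Rightarrow> 'k::comm_ring_1 poly" where
  "word M = monom 1 (list_encode M)"

definition ext :: "(nat list \<Rightarrow> 'k::comm_ring_1 poly) \<Rightarrow> 'k poly \<Rightarrow> 'k poly" where
  "ext h = lin (\<lambda>n. h (list_decode n))"

lemma ext_word [simp]: "ext h (word M) = h M"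
  by (simp add: ext_def word_def lin_monom)

lemma ext_linear: "ext h (p + q) = ext h p + ext h q" "ext h (p - q) = ext h p - ext h q"
  "ext h (smult c p) = smult c (ext h p)" "ext h 0 = 0"
  by (simp_all add: ext_def lin_add lin_diff lin_smult)

locale poly_lie_algebra = lie_algebra_on smult UNIV bracket
  for bracket :: "'k::field poly \<Rightarrow> 'k poly \<Rightarrow> 'k poly"
begin

abbreviation X :: "nat \<Rightarrow> 'k poly" where "X i \<equiv> monom 1 i"

lemma bracket_linear:
  "bracket (x + y) z = bracket x z + bracket y z" "bracket x (y + z) = bracket x y + bracket x z"
  "bracket (smult c x) y = smult c (bracket x y)" "bracket x (smult c y) = smult c (bracket x y)"
  by (simp_all add: bracket_add_left bracket_add_right bracket_scale_left bracket_scale_right)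

lemma bracket_self_0 [simp]: "bracket x x = 0"
  by (simp add: bracket_self)

lemma bracket_swap: "bracket y x = - bracket x y"
proof -
  have "bracket (x + y) (x + y) = (bracket x x + bracket y x) + (bracket x y + bracket y y)"
    by (simp only: bracket_linear)
  then have "bracket y x + bracket x y = 0" by simp
  then show ?thesis by (simp add: eq_neg_iff_add_eq_0)
qed

lemma bracket_minus: "bracket x (- y) = - bracket x y"
  using bracket_linear(4)[of x "- 1" y] by simp

lemma jacobi_derivation: "bracket (bracket x y) z = bracket x (bracket y z) - bracket y (bracket x z)"
proof -
  have "bracket x (bracket y z) + bracket y (bracket z x) + bracket z (bracket x y) = 0"
    by (rule jacobi) auto
  then show ?thesis
    using bracket_swap[of x z] bracket_swap[of z "bracket x y"]
    by (simp add: bracket_minus algebra_simps)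
qed

text \<open>
  The first argument is fuel: \<open>act n\<close> is the intended action on words of length at most \<open>n\<close>. For
  \<open>j < i\<close> it is forced by
  \<open>x\<^sub>i x\<^sub>j N = x\<^sub>j (x\<^sub>i N) + [x\<^sub>i, x\<^sub>j] N\<close>, where \<open>x\<^sub>i N\<close> is the sorted word \<open>insort i N\<close>
  up to shorter words.
\<close>

primrec act :: "nat \<Rightarrow> nat \<Rightarrow> nat list \<Rightarrow> 'k poly" where
  "act 0 i M = word (i # M)"
| "act (Suc n) i M = (case M of [] \<Rightarrow> word [i]
    | j # N \<Rightarrow> if i \<le> j then word (i # j # N)
        else word (j # insort i N) + ext (act n j) (act n i N - word (insort i N))
          + lin (\<lambda>k. act n k N) (bracket (X i) (X j)))"

text \<open>The filtration by word length, corresponding to the degree filtration of the symmetric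
  algebra.\<close>

definition V :: "nat \<Rightarrow> 'k poly set" where
  "V m = span {word K |K. sorted K \<and> length K \<le> m}"

lemma V_word: "sorted K \<Longrightarrow> length K \<le> m \<Longrightarrow> word K \<in> V m"
  unfolding V_def by (rule span_base) auto

lemma V_mono: "m \<le> n \<Longrightarrow> V m \<subseteq> V n"
  unfolding V_def by (rule span_mono) auto

lemma V_closed: "0 \<in> V m" "x \<in> V m \<Longrightarrow> y \<in> V m \<Longrightarrow> x + y \<in> V m"
  "x \<in> V m \<Longrightarrow> y \<in> V m \<Longrightarrow> x - y \<in> V m" "x \<in> V m \<Longrightarrow> smult c x \<in> V m"
  unfolding V_def by (auto intro: span_zero span_add span_diff span_scale)

lemma lin_in_V: "(\<And>i. F i \<in> V m) \<Longrightarrow> lin F p \<in> V m"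
  unfolding lin_def V_def by (intro span_sum span_scale) auto

lemma V_induct:
  assumes "p \<in> V m" and "\<And>K. sorted K \<Longrightarrow> length K \<le> m \<Longrightarrow> P (word K)"
    and "subspace {p. P p}"
  shows "P p"
  using assms(1) unfolding V_def
proof (induction rule: span_induct)
  case base
  show ?case using assms(3) .
qed (use assms(2) in auto)

lemma ext_in_V:
  assumes "p \<in> V m" "\<And>K. sorted K \<Longrightarrow> length K \<le> m \<Longrightarrow> h K \<in> V m'"
  shows "ext h p \<in> V m'"
  using assms(1)
  by (rule V_induct) (auto simp: assms(2) subspace_def ext_linear V_closed)

lemma ext_cong:
  assumes "p \<in> V m" "\<And>K. sorted K \<Longrightarrow> length K \<le> m \<Longrightarrow> h K = h' K"
  shows "ext h p = ext h' p"
  using assms(1)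
  by (rule V_induct) (auto simp: assms(2) subspace_def ext_linear)

text \<open>The two claims share an induction: the bound on the remainder keeps recursive calls on
  words short enough for the induction hypothesis, by which more fuel changes nothing.\<close>

lemma act_props:
  assumes "sorted M" "length M \<le> n"
  shows "act n i M - word (insort i M) \<in> V (length M) \<and> act (Suc n) i M = act n i M"
  using assms
proof (induction n arbitrary: i M)
  case 0
  then show ?case by (simp add: V_closed)
next
  case (Suc n)
  show ?case
  proof (cases "\<exists>j N. M = j # N \<and> j < i")
    case False
    then show ?thesis by (cases M) (auto simp: V_closed)
  next
    case True
    then obtain j N where M: "M = j # N" "j < i" by blast
    have N: "sorted N" "length N \<le> n" using Suc.prems M by auto
    define w where "w = act n i N - word (insort i N)"
    have w: "w \<in> V (length N)" using Suc.IH[OF N] by (simp add: w_def)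
    have len: "act n k K \<in> V (length M)" if K: "sorted K" "length K \<le> length N" for k K
    proof -
      have "act n k K - word (insort k K) \<in> V (length K)" using Suc.IH[of K k] K N by auto
      then have "act n k K - word (insort k K) \<in> V (length M)"
        using V_mono[of "length K" "length M"] K M by auto
      moreover have "word (insort k K) \<in> V (length M)"
        using K M by (intro V_word) (auto simp: sorted_insort)
      ultimately have "act n k K - word (insort k K) + word (insort k K) \<in> V (length M)"
        by (rule V_closed)
      then show ?thesis by simp
    qed
    have 1: "act (Suc n) i M - word (insort i M)
        = ext (act n j) w + lin (\<lambda>k. act n k N) (bracket (X i) (X j))"
      using M by (simp add: w_def)
    have "ext (act n j) w + lin (\<lambda>k. act n k N) (bracket (X i) (X j)) \<in> V (length M)"
      using w N by (intro V_closed ext_in_V lin_in_V len) auto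
    then have "act (Suc n) i M - word (insort i M) \<in> V (length M)" unfolding 1 .
    moreover have "act (Suc (Suc n)) i M = act (Suc n) i M"
    proof -
      have "act (Suc n) k N = act n k N" for k using Suc.IH[OF N] by blast
      moreover have "ext (act (Suc n) j) w = ext (act n j) w"
      proof (rule ext_cong[OF w])
        show "act (Suc n) j K = act n j K" if "sorted K" "length K \<le> length N" for K
          using Suc.IH[of K j] that N by auto
      qed
      ultimately have eqs: "\<And>k. act (Suc n) k N = act n k N" "ext (act (Suc n) j) w = ext (act n j) w"
        by auto
      have "act (Suc (Suc n)) i M = word (j # insort i N)
          + ext (act (Suc n) j) (act (Suc n) i N - word (insort i N))
          + lin (\<lambda>k. act (Suc n) k N) (bracket (X i) (X j))"
        using M by (subst act.simps(2)) (simp del: act.simps)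
      also have "\<dots> = word (j # insort i N) + ext (act n j) w
          + lin (\<lambda>k. act n k N) (bracket (X i) (X j))"
        by (simp only: eqs w_def[symmetric])
      also have "\<dots> = act (Suc n) i M"
        using M by (simp add: w_def)
      finally show ?thesis .
    qed
    ultimately show ?thesis ..
  qed
qed

definition R :: "nat \<Rightarrow> nat list \<Rightarrow> 'k poly" where
  "R i M = (if sorted M then act (length M) i M else 0)"

lemma act_eq_R:
  assumes "sorted M" "length M \<le> n"
  shows "act n i M = R i M"
  using assms(2)
proof (induction n rule: dec_induct)
  case base
  show ?case using assms(1) by (simp add: R_def)
next
  case (step n)
  then show ?case using act_props[of M n i] assms(1) by simp
qed

definition \<rho> :: "'k poly \<Rightarrow> 'k poly \<Rightarrow> 'k poly" where
  "\<rho> x v = lin (\<lambda>i. ext (R i) v) x"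

lemma \<rho>_left: "\<rho> (x + y) v = \<rho> x v + \<rho> y v" "\<rho> (x - y) v = \<rho> x v - \<rho> y v"
  "\<rho> (smult c x) v = smult c (\<rho> x v)" "\<rho> (- x) v = - \<rho> x v" "\<rho> 0 v = 0"
  by (simp_all add: \<rho>_def lin_add lin_diff lin_smult lin_minus)

lemma \<rho>_right: "\<rho> x (v + w) = \<rho> x v + \<rho> x w" "\<rho> x (v - w) = \<rho> x v - \<rho> x w"
  "\<rho> x (smult c v) = smult c (\<rho> x v)" "\<rho> x 0 = 0"
  by (simp_all add: \<rho>_def ext_linear lin_fun_add lin_fun_diff lin_fun_smult)

lemma \<rho>_X: "\<rho> (X i) v = ext (R i) v"
  by (simp add: \<rho>_def lin_monom)

lemma \<rho>_word_Cons: "sorted (i # M) \<Longrightarrow> \<rho> (X i) (word M) = word (i # M)"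
  by (cases M) (auto simp: \<rho>_X R_def)

lemma \<rho>_unsorted: "\<not> sorted M \<Longrightarrow> \<rho> x (word M) = 0"
  by (simp add: \<rho>_def R_def)

lemma \<rho>_word_degree: "sorted M \<Longrightarrow> \<rho> (X i) (word M) - word (insort i M) \<in> V (length M)"
  using act_props[of M "length M" i] by (simp add: \<rho>_X R_def)

text \<open>\<open>X j\<close> only prefixes \<open>j\<close> to \<open>N\<close>, so the left side
  unfolds by the recursion for \<open>act\<close>. Leading word and remainder in that recursion add
  up to \<open>X j\<close> applied to the action of \<open>X i\<close> on \<open>N\<close>.\<close>

lemma \<rho>_straighten:
  assumes "sorted (j # N)" "j < i"
  shows "\<rho> (X i) (\<rho> (X j) (word N)) = \<rho> (X j) (\<rho> (X i) (word N)) + \<rho> (bracket (X i) (X j)) (word N)"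
proof -
  have N: "sorted N" using assms by simp
  have R: "act (length N) k N = R k N" for k by (rule act_eq_R) (auto simp: N)
  define w where "w = R i N - word (insort i N)"
  have w: "w \<in> V (length N)" using \<rho>_word_degree[OF N] by (simp add: w_def \<rho>_X)
  have "sorted (j # insort i N)"
    using assms by (auto simp: sorted_insort set_insort_key)
  then have j: "word (j # insort i N) = ext (R j) (word (insort i N))"
    by (simp only: \<rho>_word_Cons[symmetric] \<rho>_X)
  have "\<rho> (X i) (\<rho> (X j) (word N)) = R i (j # N)"
    by (simp only: \<rho>_word_Cons[OF assms(1)]) (simp add: \<rho>_X)
  also have "\<dots> = word (j # insort i N) + ext (act (length N) j) w
      + lin (\<lambda>k. R k N) (bracket (X i) (X j))"
    using assms by (simp add: R_def[of i "j # N"] R w_def)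
  also have "ext (act (length N) j) w = ext (R j) w"
    by (rule ext_cong[OF w]) (rule act_eq_R)
  also have "word (j # insort i N) + ext (R j) w = ext (R j) (R i N)"
    by (simp only: j w_def ext_linear) simp
  also have "lin (\<lambda>k. R k N) (bracket (X i) (X j)) = \<rho> (bracket (X i) (X j)) (word N)"
    by (simp add: \<rho>_def)
  finally show ?thesis by (simp add: \<rho>_X)
qed

section \<open>The straightened action is a representation\<close>

definition defect :: "'k poly \<Rightarrow> 'k poly \<Rightarrow> 'k poly \<Rightarrow> 'k poly" where
  "defect x y v = \<rho> x (\<rho> y v) - \<rho> y (\<rho> x v) - \<rho> (bracket x y) v"

lemma defect_swap: "defect y x v = - defect x y v"
  by (simp add: defect_def bracket_swap[of y x] \<rho>_left)

lemma defect_self: "defect x x v = 0"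
  by (simp add: defect_def \<rho>_left)

lemma defect_right: "defect x y (v + w) = defect x y v + defect x y w"
  "defect x y (smult c v) = smult c (defect x y v)" "defect x y 0 = 0"
  by (simp_all add: defect_def \<rho>_right smult_diff_right)

lemma defect_eq_0_basis:
  assumes "\<And>i j. defect (X i) (X j) v = 0"
  shows "defect x y v = 0"
proof -
  have 1: "defect (X i) y v = 0" for i
  proof -
    have "defect (X i) y v = lin (\<lambda>j. defect (X i) (X j) v) y"
      by (rule additive_eq_lin)
        (simp_all add: defect_def \<rho>_left \<rho>_right bracket_linear smult_diff_right)
    then show ?thesis by (simp add: assms)
  qed
  have "defect x y v = lin (\<lambda>i. defect (X i) y v) x"
    by (rule additive_eq_lin)
      (simp_all add: defect_def \<rho>_left \<rho>_right bracket_linear smult_diff_right)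
  then show ?thesis by (simp add: 1)
qed

lemma defect_V:
  assumes "\<And>K i j. sorted K \<Longrightarrow> length K \<le> m \<Longrightarrow> defect (X i) (X j) (word K) = 0" and "v \<in> V m"
  shows "defect x y v = 0"
  using assms(2)
proof (rule V_induct)
  show "subspace {v. defect x y v = 0}"
    by (auto simp: subspace_def defect_right)
qed (rule defect_eq_0_basis, rule assms(1))

text \<open>If \<open>j # N\<close> is not sorted, then \<open>N = k # P\<close> with
  \<open>k < j < i\<close>. Moving \<open>X k\<close> to the front of both products reduces the
  claim to \<open>P\<close>, and the Jacobi identity accounts for the brackets collected on the
  way.\<close>

lemma defect_word_less:
  assumes N: "sorted N" and "j < i"
    and IH: "\<And>K i j. sorted K \<Longrightarrow> length K < length N \<Longrightarrow> defect (X i) (X j) (word K) = 0"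
  shows "defect (X i) (X j) (word N) = 0"
proof (cases "sorted (j # N)")
  case True
  then show ?thesis using \<rho>_straighten[OF True \<open>j < i\<close>] by (simp add: defect_def)
next
  case False
  then obtain k P where NP: "N = k # P" "k < j"
    using N by (cases N) (auto simp: not_le intro: order_trans)
  have P: "sorted P" and kP: "sorted (k # P)" using N NP by auto
  have small: "defect x y v = 0" if "v \<in> V (length P)" for x y v
    by (rule defect_V[OF _ that], rule IH) (auto simp: NP)
  have straight: "defect (X l) (X k) (word (insort m P)) = 0" if "k < l" "k < m" for l m
    using \<rho>_straighten[of k "insort m P" l] that kP
    by (auto simp: defect_def sorted_insort set_insort_key)
  \<comment> \<open>\<open>insort m P\<close> is as long as \<open>N\<close>, so the induction
    hypothesis does not reach it; straightening does, \<open>k\<close> being smallest. The remainder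
    consists of shorter words.\<close>
  have *: "defect (X l) (X k) (\<rho> (X m) (word P)) = 0" if "k < l" "k < m" for l m
  proof -
    have "defect (X l) (X k) (\<rho> (X m) (word P)) = defect (X l) (X k) (word (insort m P))
        + defect (X l) (X k) (\<rho> (X m) (word P) - word (insort m P))"
      by (simp add: defect_def \<rho>_right)
    then show ?thesis
      using straight[OF that] small[OF \<rho>_word_degree[OF P]] by simp
  qed
  let ?u = "word P"
  have PV: "?u \<in> V (length P)" by (rule V_word) (auto simp: P)
  have N': "word N = \<rho> (X k) ?u" using \<rho>_word_Cons[OF kP] NP by simp
  have swap: "\<rho> x (\<rho> y ?u) = \<rho> y (\<rho> x ?u) + \<rho> (bracket x y) ?u" for x y
    using small[OF PV, of x y] by (simp add: defect_def algebra_simps)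
  have swap': "\<rho> (X l) (\<rho> (X k) (\<rho> (X m) ?u))
      = \<rho> (X k) (\<rho> (X l) (\<rho> (X m) ?u)) + \<rho> (bracket (X l) (X k)) (\<rho> (X m) ?u)"
    if "k < l" "k < m" for l m
    using *[OF that] by (simp add: defect_def algebra_simps)
  \<comment> \<open>The two middle terms trade places when \<open>l\<close> and \<open>m\<close> do,
    so they cancel in the difference formed below.\<close>
  have step: "\<rho> (X l) (\<rho> (X m) (word N)) = \<rho> (X k) (\<rho> (X l) (\<rho> (X m) ?u))
      + \<rho> (bracket (X l) (X k)) (\<rho> (X m) ?u) + \<rho> (bracket (X m) (X k)) (\<rho> (X l) ?u)
      + \<rho> (bracket (X l) (bracket (X m) (X k))) ?u" if "k < l" "k < m" for l m
  proof -
    have "\<rho> (X l) (\<rho> (X m) (word N))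
        = \<rho> (X l) (\<rho> (X k) (\<rho> (X m) ?u)) + \<rho> (X l) (\<rho> (bracket (X m) (X k)) ?u)"
      by (simp only: N' swap[of "X m" "X k"] \<rho>_right)
    also have "\<rho> (X l) (\<rho> (bracket (X m) (X k)) ?u)
        = \<rho> (bracket (X m) (X k)) (\<rho> (X l) ?u) + \<rho> (bracket (X l) (bracket (X m) (X k))) ?u"
      by (rule swap)
    finally show ?thesis by (simp add: swap'[OF that] add.assoc)
  qed
  have "k < i" using NP \<open>j < i\<close> by simp
  have "\<rho> (X i) (\<rho> (X j) (word N)) - \<rho> (X j) (\<rho> (X i) (word N))
      = \<rho> (X k) (\<rho> (X i) (\<rho> (X j) ?u) - \<rho> (X j) (\<rho> (X i) ?u))
        + \<rho> (bracket (X i) (bracket (X j) (X k)) - bracket (X j) (bracket (X i) (X k))) ?u"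
    by (simp add: step[OF \<open>k < i\<close> \<open>k < j\<close>] step[OF \<open>k < j\<close> \<open>k < i\<close>] \<rho>_right \<rho>_left)
  also have "\<dots> = \<rho> (X k) (\<rho> (bracket (X i) (X j)) ?u) + \<rho> (bracket (bracket (X i) (X j)) (X k)) ?u"
    by (simp only: jacobi_derivation swap[of "X i" "X j"]) simp
  also have "\<dots> = \<rho> (bracket (X i) (X j)) (\<rho> (X k) ?u)"
    by (rule swap[symmetric])
  finally show ?thesis by (simp add: defect_def N')
qed

lemma defect_word: "sorted N \<Longrightarrow> defect (X i) (X j) (word N) = 0"
proof (induction "length N" arbitrary: N i j rule: less_induct)
  case less
  have lt: "defect (X i') (X j') (word N) = 0" if "j' < i'" for i' j'
    by (rule defect_word_less[OF less.prems that]) (rule less.hyps)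
  consider "j < i" | "i < j" | "i = j" by linarith
  then show ?case
  proof cases
    case 2
    then show ?thesis using lt[OF 2] defect_swap[of "X i" "X j" "word N"] by simp
  qed (auto simp: lt defect_self)
qed

lemma defect_0: "defect x y v = 0"
proof -
  have *: "defect x y (monom 1 n) = 0" for n
  proof -
    have n: "monom 1 n = word (list_decode n)" by (simp add: word_def)
    show ?thesis
    proof (cases "sorted (list_decode n)")
      case True
      then show ?thesis unfolding n by - (rule defect_eq_0_basis, rule defect_word)
    next
      case False
      then show ?thesis unfolding n by (simp add: defect_def \<rho>_unsorted \<rho>_right)
    qed
  qed
  have "defect x y v = lin (\<lambda>n. defect x y (monom 1 n)) v"
    by (rule additive_eq_lin) (simp_all add: defect_right)
  then show ?thesis by (simp add: *)
qed

definition rep :: "'k poly \<Rightarrow> 'k endo" where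
  "rep x = mat (\<lambda>n. \<rho> x (monom 1 n))"

lemma lin_col_rep: "lin (col (rep x)) v = \<rho> x v"
proof -
  have "\<rho> x v = lin (\<lambda>n. \<rho> x (monom 1 n)) v"
    by (rule additive_eq_lin) (simp_all add: \<rho>_right)
  moreover have "col (rep x) = (\<lambda>n. \<rho> x (monom 1 n))" by (simp add: rep_def fun_eq_iff)
  ultimately show ?thesis by simp
qed

lemma rep_add: "rep (x + y) = rep x + rep y"
  and rep_smult: "rep (smult c x) = scaleE c (rep x)"
  by (rule endo_eqI, simp add: rep_def col_simps \<rho>_left)+

lemma rep_bracket: "rep (bracket x y) = commutator (rep x) (rep y)"
proof (rule endo_eqI)
  fix n
  have "col (rep x * rep y) n = \<rho> x (\<rho> y (monom 1 n))" for x y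
    by (simp add: col_simps lin_col_rep) (simp add: rep_def)
  then show "col (rep (bracket x y)) n = col (commutator (rep x) (rep y)) n"
    using defect_0[of x y "monom 1 n"]
    by (simp add: commutator_def col_simps(4)) (simp add: rep_def defect_def)
qed

text \<open>Applied to the empty word, \<open>x\<close> becomes the combination of one-letter words
  with the same coefficients, and these words are distinct basis vectors.\<close>

lemma rep_eq_0_iff: "rep x = 0 \<longleftrightarrow> x = 0"
proof
  assume "rep x = 0"
  have "coeff x n = 0" for n
  proof -
    have "0 = \<rho> x (word [])"
      using \<open>rep x = 0\<close> lin_col_rep[of x "word []"] by (simp add: col_simps(1)[abs_def] lin_def)
    also have "\<dots> = lin (\<lambda>i. word [i]) x" by (simp add: \<rho>_def R_def)
    finally have "0 = coeff (lin (\<lambda>i. word [i]) x) (list_encode [n])" by simp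
    also have "\<dots> = (\<Sum>i\<le>degree x. coeff x i * coeff (word [i] :: 'k poly) (list_encode [n]))"
      by (simp add: lin_def coeff_sum)
    also have "\<dots> = (\<Sum>i\<le>degree x. if i = n then coeff x i else 0)"
      by (rule sum.cong)
        (auto simp: word_def list_encode_eq simp del: list_encode.simps)
    also have "\<dots> = coeff x n" by (auto simp: coeff_eq_0)
    finally show ?thesis by simp
  qed
  then show "x = 0" by (simp add: poly_eq_iff)
next
  assume "x = 0"
  then show "rep x = 0" by (simp add: rep_def endo_eqI col_simps \<rho>_left)
qed

end

section \<open>The operators\<close>

text \<open>
  The pairing function identifies the space \<open>U\<close> of polynomials with a direct sum of copies of \<open>U\<close>,
  and also with a tensor product of \<open>U\<close> with a polynomial ring \<open>k[t]\<close>.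
\<close>

abbreviation B :: "nat \<Rightarrow> nat \<Rightarrow> 'k::comm_ring_1 poly" where
  "B m n \<equiv> monom 1 (prod_encode (m, n))"

definition bmat :: "(nat \<Rightarrow> nat \<Rightarrow> 'k::comm_ring_1 poly) \<Rightarrow> 'k endo" where
  "bmat F = mat (\<lambda>i. case prod_decode i of (m, n) \<Rightarrow> F m n)"

lemma col_bmat [simp]: "col (bmat F) (prod_encode (m, n)) = F m n"
  by (simp add: bmat_def)

lemma endo_eqI2:
  assumes "\<And>m n. col a (prod_encode (m, n)) = col b (prod_encode (m, n))"
  shows "a = b"
  by (rule endo_eqI) (metis assms prod_decode_inverse surj_pair)

definition inj_op :: "nat \<Rightarrow> 'k::comm_ring_1 endo" where
  "inj_op a = mat (\<lambda>n. B a n)"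

definition proj_op :: "nat \<Rightarrow> 'k::comm_ring_1 endo" where
  "proj_op a = bmat (\<lambda>m n. if m = a then monom 1 n else 0)"

definition shift_op :: "'k::comm_ring_1 endo" where
  "shift_op = bmat (\<lambda>m n. B (Suc m) n)"

definition unshift_op :: "'k::comm_ring_1 endo" where
  "unshift_op = bmat (\<lambda>m n. if m = 0 then 0 else B (m - 1) n)"

text \<open>
  With \<open>f\<close> the shift, \<open>g = code_op y\<close> satisfies \<open>g f f = inj_op 0\<close>, and \<open>g\<close> maps the subspace
  \<open>inj_op 0 (inj_op i U)\<close> as \<open>y i\<close>. So every \<open>y i\<close> is a word in \<open>f\<close> and \<open>g\<close>. The zero on
  \<open>inj_op 1 U\<close> makes \<open>g f g f f\<close> vanish.
\<close>

definition code_op :: "(nat \<Rightarrow> 'k::comm_ring_1 endo) \<Rightarrow> 'k endo" where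
  "code_op y = bmat (\<lambda>m n. case m of 0 \<Rightarrow> (case prod_decode n of (i, j) \<Rightarrow> col (y i) j)
     | Suc 0 \<Rightarrow> 0 | Suc (Suc i) \<Rightarrow> B 0 (prod_encode (i, n)))"

lemma proj_inj: "proj_op a * inj_op b = (if a = b then 1 else 0)"
  by (rule endo_eqI) (simp add: col_simps inj_op_def proj_op_def lin_monom)

lemma unshift_shift: "unshift_op * shift_op = 1"
  by (rule endo_eqI2) (simp add: col_simps shift_op_def unshift_op_def lin_monom)

lemma shift_inj: "shift_op * inj_op a = inj_op (Suc a)"
  by (rule endo_eqI) (simp add: col_simps inj_op_def shift_op_def lin_monom)

lemma shift_power_inj: "shift_op ^ i * inj_op 0 = inj_op i"
  by (induction i) (simp_all add: shift_inj mult.assoc)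

lemma code_shift_shift: "code_op y * shift_op * shift_op = inj_op 0"
  by (rule endo_eqI2) (simp add: col_simps inj_op_def shift_op_def code_op_def lin_monom lin_lin)

lemma code_shift_inj: "code_op y * shift_op * inj_op 0 = 0"
  by (rule endo_eqI) (simp add: col_simps inj_op_def shift_op_def code_op_def lin_monom)

lemma code_inj_inj: "code_op y * inj_op 0 * inj_op i = y i"
  by (rule endo_eqI) (simp add: col_simps inj_op_def code_op_def lin_monom)

lemma assoc_algebra_scaleE: "assoc_algebra (scaleE :: 'k::field \<Rightarrow> _)"
proof -
  interpret vector_space "scaleE :: 'k \<Rightarrow> _" by (rule vector_space_scaleE)
  show ?thesis by unfold_locales (simp_all add: scaleE_mult)
qed

interpretation E: assoc_algebra "scaleE :: 'k::field \<Rightarrow> _"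
  by (rule assoc_algebra_scaleE)

interpretation E: two_letter_algebra "scaleE :: 'k::field \<Rightarrow> _" f g for f g ..

lemma countable_in_two_letter_algebra:
  fixes Y :: "'k::field endo set"
  assumes "countable Y"
  obtains f g :: "'k endo" and a b k where
    "matrix_generators scaleE f g inj_op proj_op a b" "k \<in> E.C f g" "k * f = 1" "Y \<subseteq> E.C f g"
proof -
  let ?f = "shift_op :: 'k endo"
  \<comment> \<open>The additions to \<open>Y\<close> supply the witnesses: \<open>b\<close> is
    \<open>proj_op 2\<close>, \<open>k\<close> is \<open>unshift_op\<close>, and the word coding the
    shift, without its leading \<open>g\<close>, is \<open>a\<close>, so that
    \<open>g * a = f\<close>.\<close>
  define Y' where "Y' = {?f, proj_op 2, unshift_op} \<union> Y"
  define y where "y = from_nat_into Y'"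
  have Y': "range y = Y'"
    unfolding y_def by (rule range_from_nat_into) (auto simp: Y'_def assms)
  define g where "g = code_op y"
  note C = E.C_intros
  have f_pow: "?f ^ i \<in> E.C ?f g" for i by (induction i) (auto intro: C)
  \<comment> \<open>Since \<open>g * f * f = inj_op 0\<close>, powers of the shift give every
    \<open>inj_op i\<close>, and \<open>inj_op 0 * inj_op i\<close> addresses the part of
    \<open>g\<close> that acts as \<open>y i\<close>.\<close>
  have y_eq: "g * (g * ?f * ?f * ?f ^ i * (g * ?f * ?f)) = y i" for i
  proof -
    have "g * (g * ?f * ?f * ?f ^ i * (g * ?f * ?f)) = g * inj_op 0 * (?f ^ i * inj_op 0)"
      by (simp only: g_def code_shift_shift mult.assoc[of "inj_op 0"] mult.assoc[of "code_op y"])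
    then show ?thesis by (simp add: g_def shift_power_inj code_inj_inj)
  qed
  have "y i \<in> E.C ?f g" for i
    unfolding y_eq[symmetric] by (intro C f_pow)
  then have Y'C: "Y' \<subseteq> E.C ?f g" using Y' by auto
  obtain i where i: "y i = ?f" using Y' by (metis Y'_def UnI1 insertI1 rangeE)
  define a where "a = g * ?f * ?f * ?f ^ i * (g * ?f * ?f)"
  have "matrix_generators scaleE ?f g inj_op proj_op a (proj_op 2)"
  proof
    show "proj_op m * inj_op n = (if m = n then 1 else 0 :: 'k endo)" for m n
      by (rule proj_inj)
    have "g * ?f * g * ?f * ?f = g * ?f * (g * ?f * ?f)" by (simp only: mult.assoc)
    also have "\<dots> = 0" by (simp only: g_def code_shift_shift code_shift_inj)
    finally show "g * ?f * g * ?f * ?f = 0" .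
    show "a \<in> E.C ?f g" unfolding a_def by (intro C f_pow)
    show "proj_op 2 \<in> E.C ?f g" using Y'C by (auto simp: Y'_def)
    have "proj_op 2 * ?f * ?f * g * ?f * g * a = proj_op 2 * ?f * ?f * g * ?f * (g * a)"
      by (simp only: mult.assoc)
    also have "g * a = ?f" unfolding a_def y_eq i ..
    also have "proj_op 2 * ?f * ?f * g * ?f * ?f = proj_op 2 * (?f * (?f * (g * ?f * ?f)))"
      by (simp only: mult.assoc)
    also have "\<dots> = 1"
      by (simp add: g_def code_shift_shift shift_inj proj_inj numeral_2_eq_2)
    finally show "proj_op 2 * ?f * ?f * g * ?f * g * a = 1" .
  qed
  moreover have "unshift_op \<in> E.C ?f g" "Y \<subseteq> E.C ?f g" using Y'C by (auto simp: Y'_def)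
  ultimately show thesis using that unshift_shift by blast
qed

text \<open>\<open>F\<close> tensored with the identity of \<open>k[t]\<close>; here
  \<open>B m n\<close> stands for basis vector \<open>m\<close> tensored with
  \<open>t^n\<close>.\<close>

definition hat :: "'k::comm_ring_1 endo \<Rightarrow> 'k endo" where
  "hat F = bmat (\<lambda>m n. lin (\<lambda>i. B i n) (col F m))"

definition t_op :: "'k::comm_ring_1 endo" where
  "t_op = bmat (\<lambda>m n. B m (Suc n))"

text \<open>At \<open>n = 0\<close> the exponent \<open>n - 1\<close> is truncated, but the
  coefficient vanishes.\<close>

definition dt_op :: "'k::comm_ring_1 endo" where
  "dt_op = bmat (\<lambda>m n. smult (of_nat n) (B m (n - 1)))"

lemma hat_add: "hat (F + G) = hat F + hat G"
  by (rule endo_eqI2) (simp add: col_simps hat_def lin_add)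

lemma hat_scale: "hat (scaleE c F) = scaleE c (hat F)"
  by (rule endo_eqI2) (simp add: col_simps hat_def lin_smult)

lemma hat_mult: "hat (F * G) = hat F * hat G"
  by (rule endo_eqI2) (simp add: col_simps hat_def lin_lin lin_monom)

lemma hat_commutator: "hat (commutator F G) = commutator (hat F) (hat G)"
proof -
  have "hat (F * G - G * F) + hat (G * F) = hat (F * G)"
    by (simp flip: hat_add)
  then show ?thesis by (simp add: commutator_def hat_mult eq_diff_eq)
qed

lemma dt_t: "commutator dt_op t_op = 1"
proof (rule endo_eqI2)
  fix m n
  show "col (commutator dt_op t_op) (prod_encode (m, n)) = col 1 (prod_encode (m, n))"
    by (cases n)
      (simp_all add: commutator_def col_simps dt_op_def t_op_def lin_monom smult_monom diff_monom)
qed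

lemma dt_hat: "dt_op * hat F = hat F * dt_op"
proof (rule endo_eqI2)
  fix m n
  have "col (dt_op * hat F) (prod_encode (m, n))
      = lin (\<lambda>i. smult (of_nat n) (B i (n - 1))) (col F m)"
    by (simp add: col_simps hat_def dt_op_def lin_lin lin_monom)
  also have "\<dots> = col (hat F * dt_op) (prod_encode (m, n))"
    by (simp add: col_simps hat_def dt_op_def lin_smult lin_monom lin_fun_smult)
  finally show "col (dt_op * hat F) (prod_encode (m, n)) = col (hat F * dt_op) (prod_encode (m, n))" .
qed

text \<open>\<open>hat F\<close> commutes with d/dt, so it can be multiplied onto the relation
  \<open>dt_t\<close>. Thus \<open>E11_commutator_in_S\<close> applies to \<open>hat F\<close> even
  if \<open>F\<close> is no commutator.\<close>

lemma hat_is_commutator: "commutator dt_op (t_op * hat F) = hat F"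
proof -
  have "commutator dt_op (t_op * hat F) = commutator dt_op t_op * hat F"
    by (simp add: commutator_def algebra_simps dt_hat)
  then show ?thesis by (simp add: dt_t)
qed

text \<open>\<open>F\<close> may have rank 1, but \<open>hat F\<close> repeats it for each power of
  \<open>t\<close>. \<open>q\<close> sends basis vector \<open>n\<close> to \<open>B m n\<close> for
  a nonzero column \<open>m\<close> of \<open>F\<close>; \<open>p\<close> reads off a nonzero
  coordinate \<open>r\<close> and divides by it.\<close>

lemma hat_full:
  fixes F :: "'k::field endo"
  assumes "F \<noteq> 0"
  obtains p q where "p * hat F * q = 1"
proof -
  obtain m where "col F m \<noteq> 0"
    using assms by (metis endo_eqI col_simps(1))
  then obtain r where r: "coeff (col F m) r \<noteq> 0" by (auto simp: poly_eq_iff)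
  let ?c = "coeff (col F m) r"
  define p :: "'k endo" where "p = bmat (\<lambda>i n. if i = r then monom (inverse ?c) n else 0)"
  have "p * (hat F * inj_op m) = 1"
  proof (rule endo_eqI)
    fix n
    have "col (p * (hat F * inj_op m)) n
        = lin (\<lambda>i. if i = r then monom (inverse ?c) n else 0) (col F m)"
      by (simp add: col_simps hat_def inj_op_def p_def lin_lin lin_monom)
    also have "\<dots> = (\<Sum>i\<le>degree (col F m). if i = r then smult ?c (monom (inverse ?c) n) else 0)"
      unfolding lin_def by (rule sum.cong) auto
    also have "\<dots> = smult ?c (monom (inverse ?c) n)"
      using le_degree[OF r] by simp
    finally show "col (p * (hat F * inj_op m)) n = col 1 n"
      using r by (simp add: smult_monom col_simps)
  qed
  then show thesis by (intro that[of p "inj_op m"]) (simp add: mult.assoc)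
qed

section \<open>Subalgebras, ideals and quotients\<close>

context lie_algebra_on
begin

lemma lie_subalgebra_L: "lie_subalgebra L"
  by (simp add: lie_subalgebra_def subspace_L bracket_closed)

lemma lie_subalgebra_hull:
  assumes "G \<subseteq> L" shows "lie_subalgebra (lie_subalgebra hull G)"
proof -
  let ?F = "{t. lie_subalgebra t \<and> G \<subseteq> t}"
  have "subspace (\<Inter>?F)"
    by (rule subspace_Inter) (auto simp: lie_subalgebra_def)
  moreover have "\<Inter>?F \<subseteq> L"
    using assms lie_subalgebra_L by blast
  moreover have "\<forall>x\<in>\<Inter>?F. \<forall>y\<in>\<Inter>?F. bracket x y \<in> \<Inter>?F"
    by (auto simp: lie_subalgebra_def)
  ultimately have "lie_subalgebra (\<Inter>?F)"
    unfolding lie_subalgebra_def[of "\<Inter>?F"] by (intro conjI)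
  then show ?thesis by (simp only: hull_def)
qed

lemma lie_ideal_closed:
  assumes "lie_ideal I"
  shows "subspace I" "I \<subseteq> L" "x \<in> L \<Longrightarrow> y \<in> I \<Longrightarrow> bracket x y \<in> I"
  using assms by (auto simp: lie_ideal_def)

lemma L_closed: "0 \<in> L" "x \<in> L \<Longrightarrow> y \<in> L \<Longrightarrow> x + y \<in> L" "x \<in> L \<Longrightarrow> y \<in> L \<Longrightarrow> x - y \<in> L"
  "x \<in> L \<Longrightarrow> scale c x \<in> L"
  using subspace_L by (auto intro: subspace_0 subspace_add subspace_diff subspace_scale)

lemma bracket_0_right: "x \<in> L \<Longrightarrow> bracket x 0 = 0"
  using bracket_add_right[of x 0 0] L_closed(1) by simp

lemma bracket_swap: "x \<in> L \<Longrightarrow> y \<in> L \<Longrightarrow> bracket y x = - bracket x y"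
  using bracket_self[of "x + y"] bracket_self[of x] bracket_self[of y]
  by (simp add: bracket_add_left bracket_add_right L_closed eq_neg_iff_add_eq_0)

lemma bracket_diff_left:
  "x \<in> L \<Longrightarrow> y \<in> L \<Longrightarrow> z \<in> L \<Longrightarrow> bracket (x - y) z = bracket x z - bracket y z"
  using bracket_add_left[of "x - y" y z] by (simp add: L_closed)

lemma bracket_diff_right:
  "x \<in> L \<Longrightarrow> y \<in> L \<Longrightarrow> z \<in> L \<Longrightarrow> bracket x (y - z) = bracket x y - bracket x z"
  using bracket_add_right[of x "y - z" z] by (simp add: L_closed)

lemma zero_ideal: "lie_ideal {0}"
  by (auto simp: lie_ideal_def L_closed bracket_0_right)

lemma lie_ideal_bracket_left:
  assumes "lie_ideal I" "x \<in> I" "y \<in> L" shows "bracket x y \<in> I"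
  using assms lie_ideal_closed[OF assms(1)] bracket_swap[of y x] subspace_neg[of I] by force

lemma lie_algebra_on_subalgebra:
  assumes "lie_subalgebra S" shows "lie_algebra_on scale S bracket"
proof -
  have "S \<subseteq> L" "subspace S" "\<And>x y. x \<in> S \<Longrightarrow> y \<in> S \<Longrightarrow> bracket x y \<in> S"
    using assms by (auto simp: lie_subalgebra_def)
  then show ?thesis
    by unfold_locales
      (auto simp: subset_iff bracket_add_left bracket_add_right bracket_scale_left
        bracket_scale_right bracket_self jacobi)
qed

text \<open>The stages \<open>T n\<close> add sums, brackets and multiples of earlier elements. Each
  is countable over a countable field, and their union is a subalgebra containing
  \<open>G\<close>.\<close>

lemma countable_hull:
  assumes k: "countable (UNIV :: 'k set)" and G: "countable G" "G \<subseteq> L"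
  shows "countable (lie_subalgebra hull G)"
proof -
  define step where "step A = A \<union> (\<lambda>(x, y). x + y) ` (A \<times> A) \<union> (\<lambda>(x, y). bracket x y) ` (A \<times> A)
    \<union> (\<lambda>(c, x). scale c x) ` (UNIV \<times> A)" for A
  define T where "T n = (step ^^ n) (insert 0 G)" for n
  have T_Suc: "T (Suc n) = step (T n)" for n by (simp add: T_def)
  have T_countable: "countable (T n)" for n
  proof (induction n)
    case 0
    then show ?case using G by (simp add: T_def)
  next
    case (Suc n)
    then show ?case unfolding T_Suc step_def by (intro countable_Un countable_image countable_SIGMA k)
  qed
  have T_L: "T n \<subseteq> L" for n
  proof (induction n)
    case 0
    then show ?case using G by (simp add: T_def L_closed)
  next
    case (Suc n)
    then show ?case unfolding T_Suc step_def by (auto intro: L_closed bracket_closed)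
  qed
  have T_mono: "T m \<subseteq> T n" if "m \<le> n" for m n
    using that by (induction rule: dec_induct) (auto simp: T_Suc step_def)
  have "lie_subalgebra (\<Union>n. T n)"
    unfolding lie_subalgebra_def
  proof (intro conjI ballI)
    have both: "\<exists>n. x \<in> T n \<and> y \<in> T n" if "x \<in> (\<Union>n. T n)" "y \<in> (\<Union>n. T n)" for x y
    proof -
      obtain m n where "x \<in> T m" "y \<in> T n" using \<open>x \<in> (\<Union>n. T n)\<close> \<open>y \<in> (\<Union>n. T n)\<close> by blast
      then have "x \<in> T (max m n) \<and> y \<in> T (max m n)"
        using T_mono[of m "max m n"] T_mono[of n "max m n"] by auto
      then show ?thesis ..
    qed
    show "subspace (\<Union>n. T n)"
    proof (rule subspaceI)
      have "0 \<in> T 0" by (simp add: T_def)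
      then show "0 \<in> (\<Union>n. T n)" by blast
      show "x + y \<in> (\<Union>n. T n)" if xy: "x \<in> (\<Union>n. T n)" "y \<in> (\<Union>n. T n)" for x y
      proof -
        obtain n where "x \<in> T n" "y \<in> T n" using both[OF xy] by blast
        then have "x + y \<in> T (Suc n)" unfolding T_Suc step_def by force
        then show ?thesis by blast
      qed
      show "scale c x \<in> (\<Union>n. T n)" if x: "x \<in> (\<Union>n. T n)" for c x
      proof -
        obtain n where "x \<in> T n" using x by blast
        then have "scale c x \<in> T (Suc n)" unfolding T_Suc step_def by force
        then show ?thesis by blast
      qed
    qed
    show "(\<Union>n. T n) \<subseteq> L" using T_L by blast
    show "bracket x y \<in> (\<Union>n. T n)" if xy: "x \<in> (\<Union>n. T n)" "y \<in> (\<Union>n. T n)" for x y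
    proof -
      obtain n where "x \<in> T n" "y \<in> T n" using both[OF xy] by blast
      then have "bracket x y \<in> T (Suc n)" unfolding T_Suc step_def by force
      then show ?thesis by blast
    qed
  qed
  moreover have "G \<subseteq> (\<Union>n. T n)" using T_def[of 0] by auto
  ultimately have "lie_subalgebra hull G \<subseteq> (\<Union>n. T n)" by (intro hull_minimal)
  then show ?thesis by (rule countable_subset) (simp add: T_countable)
qed

text \<open>Zorn's lemma: the zero ideal avoids \<open>e\<close>, and so does the union of a chain
  of ideals avoiding \<open>e\<close>.\<close>

lemma maximal_ideal_avoiding:
  assumes "e \<noteq> 0"
  obtains I where "lie_ideal I" "e \<notin> I" "\<And>J. lie_ideal J \<Longrightarrow> I \<subseteq> J \<Longrightarrow> e \<notin> J \<Longrightarrow> J = I"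
proof -
  let ?A = "{I. lie_ideal I \<and> e \<notin> I}"
  have "\<exists>M\<in>?A. \<forall>X\<in>?A. M \<subseteq> X \<longrightarrow> X = M"
  proof (rule subset_Zorn_nonempty)
    show "?A \<noteq> {}" using zero_ideal assms by blast
    fix \<C> assume ne: "\<C> \<noteq> {}" and chain: "subset.chain ?A \<C>"
    have A: "lie_ideal I" "e \<notin> I" if "I \<in> \<C>" for I
      using chain that by (auto simp: subset.chain_def)
    have lin: "I \<subseteq> J \<or> J \<subseteq> I" if "I \<in> \<C>" "J \<in> \<C>" for I J
      using chain that by (auto simp: subset.chain_def)
    have "subspace (\<Union>\<C>)"
    proof (rule subspaceI)
      show "0 \<in> \<Union>\<C>" using ne A lie_ideal_closed(1) subspace_0 by blast
      show "x + y \<in> \<Union>\<C>" if "x \<in> \<Union>\<C>" "y \<in> \<Union>\<C>" for x y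
      proof -
        obtain I J where IJ: "I \<in> \<C>" "J \<in> \<C>" "x \<in> I" "y \<in> J" using \<open>x \<in> \<Union>\<C>\<close> \<open>y \<in> \<Union>\<C>\<close> by blast
        with lin[of I J] obtain K where "K \<in> \<C>" "x \<in> K" "y \<in> K" by blast
        then show ?thesis using A lie_ideal_closed(1) subspace_add by blast
      qed
      show "scale c x \<in> \<Union>\<C>" if "x \<in> \<Union>\<C>" for c x
        using that A lie_ideal_closed(1) subspace_scale by blast
    qed
    moreover have "\<Union>\<C> \<subseteq> L" "\<And>x y. x \<in> L \<Longrightarrow> y \<in> \<Union>\<C> \<Longrightarrow> bracket x y \<in> \<Union>\<C>"
      using A lie_ideal_closed by blast+
    ultimately show "\<Union>\<C> \<in> ?A" using A by (auto simp: lie_ideal_def)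
  qed
  then show thesis using that by blast
qed

end

section \<open>Quotients realised on polynomials\<close>

lemma vector_space_smult: "vector_space (smult :: 'k::field \<Rightarrow> _)"
  by unfold_locales (simp_all add: smult_add_right smult_add_left)

text \<open>A basis of \<open>I\<close> is extended to one of \<open>L\<close>. The old vectors go
  to 0, the new ones to distinct monomials, of which there are enough because \<open>L\<close> is
  countable.\<close>

lemma (in vector_space) linear_to_poly_with_kernel:
  assumes "subspace L" "countable L" "subspace I" "I \<subseteq> L"
  obtains \<phi> where "Vector_Spaces.linear scale smult \<phi>" "\<And>x. x \<in> L \<Longrightarrow> \<phi> x = 0 \<longleftrightarrow> x \<in> I"
proof -
  interpret P: vector_space_pair scale "smult :: 'a \<Rightarrow> 'a poly \<Rightarrow> 'a poly"
    by (intro vector_space_pair.intro vector_space_axioms vector_space_smult)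
  obtain A where A: "A \<subseteq> I" "independent A" "I \<subseteq> span A"
    by (rule maximal_independent_subset)
  have "A \<subseteq> L" using A(1) assms(4) by (rule order_trans)
  then obtain D where D: "A \<subseteq> D" "D \<subseteq> L" "independent D" "L \<subseteq> span D"
    using A(2) by (rule maximal_independent_subset_extend)
  have cD: "countable D" using D(2) assms(2) by (rule countable_subset)
  define \<phi> where "\<phi> = P.construct D (\<lambda>x. if x \<in> A then 0 else monom 1 (to_nat_on D x))"
  have lin: "Vector_Spaces.linear scale smult \<phi>"
    unfolding \<phi>_def by (rule P.linear_construct) (rule D)
  interpret \<phi>: Vector_Spaces.linear scale smult \<phi> by (rule lin)
  have \<phi>D: "\<phi> x = (if x \<in> A then 0 else monom 1 (to_nat_on D x))" if "x \<in> D" for x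
    unfolding \<phi>_def using D(3) that by (rule P.construct_basis)
  have \<phi>A: "\<phi> x = 0" if "x \<in> span A" for x
    using that
  proof (induction rule: span_induct)
    case base
    then show ?case by (rule \<phi>.subspace_kernel)
  next
    case (step x)
    then show ?case using \<phi>D D(1) by auto
  qed
  have inj: "z = 0" if "z \<in> span (D - A)" "\<phi> z = 0" for z
  proof -
    obtain t r where t: "finite t" "t \<subseteq> D - A" and z: "z = (\<Sum>x\<in>t. scale (r x) x)"
      using \<open>z \<in> span (D - A)\<close> by (auto simp: span_explicit)
    have "r x = 0" if "x \<in> t" for x
    proof -
      have "0 = coeff (\<phi> z) (to_nat_on D x)" using \<open>\<phi> z = 0\<close> by simp
      also have "\<phi> z = (\<Sum>y\<in>t. monom (r y) (to_nat_on D y))"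
        unfolding z \<phi>.sum \<phi>.scale using t(2)
        by (intro sum.cong) (auto simp: \<phi>D smult_monom subset_iff)
      also have "coeff \<dots> (to_nat_on D x) = (\<Sum>y\<in>t. if y = x then r y else 0)"
        unfolding coeff_sum
      proof (rule sum.cong)
        fix y assume "y \<in> t"
        then have "to_nat_on D y = to_nat_on D x \<longleftrightarrow> y = x"
          using t(2) \<open>x \<in> t\<close> cD by (intro to_nat_on_inj) auto
        then show "coeff (monom (r y) (to_nat_on D y)) (to_nat_on D x) = (if y = x then r y else 0)"
          by simp
      qed simp
      also have "\<dots> = r x" using t(1) \<open>x \<in> t\<close> by simp
      finally show ?thesis by simp
    qed
    then show ?thesis by (simp add: z)
  qed
  have "\<phi> x = 0 \<longleftrightarrow> x \<in> I" if "x \<in> L" for x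
  proof
    assume "x \<in> I" then show "\<phi> x = 0" using \<phi>A A(3) by blast
  next
    assume 0: "\<phi> x = 0"
    have "A \<union> (D - A) = D" using D(1) by blast
    then obtain y z where yz: "x = y + z" "y \<in> span A" "z \<in> span (D - A)"
      using span_Un[of A "D - A"] D(4) \<open>x \<in> L\<close> by (auto simp: subset_iff)
    then have "z = 0" using inj[OF yz(3)] 0 \<phi>A[OF yz(2)] by (simp add: \<phi>.add)
    moreover have "span A \<subseteq> I" using A(1) assms(3) by (rule span_minimal)
    ultimately show "x \<in> I" using yz by auto
  qed
  with lin show thesis by (rule that)
qed

text \<open>The bracket is computed on preimages chosen by \<open>s\<close>. The choice does not
  matter, as two preimages differ by an element of the ideal \<open>I\<close>.\<close>

lemma (in lie_algebra_on) quotient_exists: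
  assumes "countable L" and I: "lie_ideal I"
  obtains M bracket' \<phi> where "lie_hom_on scale L bracket smult M bracket' \<phi>" "\<phi> ` L = M"
    "\<And>x. x \<in> L \<Longrightarrow> \<phi> x = 0 \<longleftrightarrow> x \<in> I"
proof -
  note I' = lie_ideal_closed[OF I]
  obtain \<phi> where lin: "Vector_Spaces.linear scale smult \<phi>"
    and ker: "\<And>x. x \<in> L \<Longrightarrow> \<phi> x = 0 \<longleftrightarrow> x \<in> I"
    using linear_to_poly_with_kernel[OF subspace_L assms(1) I'(1,2)] by metis
  interpret \<phi>: Vector_Spaces.linear scale smult \<phi> by (rule lin)
  define s where "s = inv_into L \<phi>"
  define bracket' where "bracket' p q = \<phi> (bracket (s p) (s q))" for p q
  have s: "s (\<phi> x) \<in> L" "\<phi> (s (\<phi> x)) = \<phi> x" if "x \<in> L" for x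
    unfolding s_def using that by (auto intro: inv_into_into f_inv_into_f)
  have s_I: "s (\<phi> x) - x \<in> I" if "x \<in> L" for x
    using ker[of "s (\<phi> x) - x"] s[OF that] that by (simp add: L_closed \<phi>.diff)
  have bracket': "bracket' (\<phi> x) (\<phi> y) = \<phi> (bracket x y)" if "x \<in> L" "y \<in> L" for x y
  proof -
    have "bracket (s (\<phi> x) - x) (s (\<phi> y)) + bracket x (s (\<phi> y) - y) \<in> I"
      using that s s_I by (intro subspace_add I' lie_ideal_bracket_left[OF I])
    then have "bracket (s (\<phi> x)) (s (\<phi> y)) - bracket x y \<in> I"
      using that s by (simp add: bracket_diff_left bracket_diff_right)
    then have "\<phi> (bracket (s (\<phi> x)) (s (\<phi> y)) - bracket x y) = 0"
      using that s ker I'(2) by blast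
    then show ?thesis by (simp add: bracket'_def \<phi>.diff)
  qed
  have sub: "module.subspace smult (\<phi> ` L)"
    by (rule \<phi>.subspace_image) (rule subspace_L)
  interpret M: vector_space "smult :: 'k \<Rightarrow> 'k poly \<Rightarrow> 'k poly" by (rule vector_space_smult)
  have add: "\<phi> x + \<phi> y = \<phi> (x + y)" and scl: "smult c (\<phi> x) = \<phi> (scale c x)" for x y c
    by (simp_all add: \<phi>.add \<phi>.scale)
  interpret M: lie_algebra_on smult "\<phi> ` L" bracket'
    by unfold_locales
      (auto simp: sub bracket' L_closed bracket_closed add scl bracket_add_left bracket_add_right
        bracket_scale_left bracket_scale_right bracket_self jacobi)
  have "lie_hom_on scale L bracket smult (\<phi> ` L) bracket' \<phi>"
    by unfold_locales (auto simp: \<phi>.add \<phi>.scale bracket')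
  then show thesis using ker that by blast
qed

section \<open>Generators and simplicity of homomorphic images\<close>

context lie_hom_on
begin

lemma hom_0: "f 0 = 0"
  using hom_add[of 0 0] by (simp add: dom.L_closed)

lemma vimage_subspace:
  assumes "cod.subspace T" shows "dom.subspace {x \<in> L1. f x \<in> T}"
  using assms
  by (auto simp: dom.subspace_def cod.subspace_def dom.L_closed hom_0 hom_add hom_scale)

text \<open>The preimage of the subalgebra generated by the images is a subalgebra containing
  \<open>G\<close>, hence all of \<open>L1\<close>.\<close>

lemma image_generated_by:
  assumes "f ` L1 = L2" "dom.generated_by G"
  shows "cod.generated_by (f ` G)"
proof -
  have G: "G \<subseteq> L1" and hull: "dom.lie_subalgebra hull G = L1"
    using assms(2) by (auto simp: dom.generated_by_def)
  have fG: "f ` G \<subseteq> L2" using G hom_closed by blast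
  let ?H = "cod.lie_subalgebra hull (f ` G)"
  have H: "cod.lie_subalgebra ?H" using fG by (rule cod.lie_subalgebra_hull)
  have "dom.lie_subalgebra {x \<in> L1. f x \<in> ?H}"
    using H vimage_subspace[of ?H]
    by (auto simp: dom.lie_subalgebra_def cod.lie_subalgebra_def dom.bracket_closed hom_bracket)
  moreover have "G \<subseteq> {x \<in> L1. f x \<in> ?H}" using G by (auto intro: hull_inc)
  ultimately have "dom.lie_subalgebra hull G \<subseteq> {x \<in> L1. f x \<in> ?H}"
    by (intro hull_minimal)
  then have "L1 \<subseteq> {x \<in> L1. f x \<in> ?H}" by (simp only: hull)
  then have "L2 \<subseteq> ?H" using assms(1) by blast
  moreover have "?H \<subseteq> L2" using H by (auto simp: cod.lie_subalgebra_def)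
  ultimately show ?thesis using fG by (auto simp: cod.generated_by_def)
qed

text \<open>Ideals of the image pull back to ideals containing the kernel \<open>I\<close>, which
  leaves two. The pair \<open>x\<close>, \<open>y\<close> rules out an abelian image.\<close>

lemma image_simple:
  assumes surj: "f ` L1 = L2"
    and ker: "\<And>x. x \<in> L1 \<Longrightarrow> f x = 0 \<longleftrightarrow> x \<in> I"
    and maximal: "\<And>J. dom.lie_ideal J \<Longrightarrow> I \<subseteq> J \<Longrightarrow> J = I \<or> J = L1"
    and nonabelian: "x \<in> L1" "y \<in> L1" "bracket1 x y \<notin> I" and I: "I \<subseteq> L1"
  shows "cod.simple"
proof -
  have "bracket2 (f x) (f y) \<noteq> 0"
    using nonabelian by (simp add: ker dom.bracket_closed flip: hom_bracket)
  then have "\<not> cod.abelian"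
    using nonabelian hom_closed by (auto simp: cod.abelian_def)
  moreover have "T = {0} \<or> T = L2" if T: "cod.lie_ideal T" for T
  proof -
    note T' = cod.lie_ideal_closed[OF T]
    let ?J = "{x \<in> L1. f x \<in> T}"
    have "dom.lie_ideal ?J"
      using vimage_subspace[OF T'(1)] T'(3)
      by (auto simp: dom.lie_ideal_def dom.bracket_closed hom_bracket hom_closed)
    moreover have "I \<subseteq> ?J"
    proof
      fix x assume "x \<in> I"
      then have "x \<in> L1" "f x = 0" using I ker by blast+
      then show "x \<in> ?J" using cod.subspace_0[OF T'(1)] by simp
    qed
    ultimately have J: "?J = I \<or> ?J = L1" by (rule maximal)
    have TJ: "T = f ` ?J" using T'(2) surj by auto
    have "T \<subseteq> {0}" if "?J = I" using TJ that ker I by (metis (no_types, lifting) imageE insertI1 subset_iff)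
    moreover have "0 \<in> T" using cod.subspace_0[OF T'(1)] .
    ultimately show ?thesis using J TJ surj by (metis empty_iff subset_singletonD)
  qed
  ultimately show ?thesis by (auto simp: cod.simple_def)
qed

end

section \<open>The embedding\<close>

text \<open>\<open>poly_lie_algebra\<close> asks for a bracket on all polynomials, while the
  embedding \<open>\<phi>\<close> of \<open>L\<close> need not be onto. Its left inverse
  \<open>\<psi>\<close> pulls arbitrary polynomials back to \<open>L\<close>, where the bracket is
  taken.\<close>

lemma (in lie_algebra_on) faithful_representation:
  assumes "countable L"
  obtains \<theta> :: "'a \<Rightarrow> 'k endo"
  where "lie_hom_on scale L bracket scaleE UNIV commutator \<theta>" "inj_on \<theta> L"
proof -
  have "subspace {0}" "{0} \<subseteq> L" by (auto simp: L_closed)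
  then obtain \<phi> where lin: "Vector_Spaces.linear scale smult \<phi>"
    and ker: "\<And>x. x \<in> L \<Longrightarrow> \<phi> x = 0 \<longleftrightarrow> x \<in> {0}"
    using linear_to_poly_with_kernel[OF subspace_L assms] by metis
  interpret \<phi>: Vector_Spaces.linear scale smult \<phi> by (rule lin)
  interpret P: vector_space_pair scale "smult :: 'k \<Rightarrow> 'k poly \<Rightarrow> 'k poly"
    by (intro vector_space_pair.intro vector_space_axioms vector_space_smult)
  have inj: "inj_on \<phi> L"
  proof (rule inj_onI)
    fix x y assume "x \<in> L" "y \<in> L" "\<phi> x = \<phi> y"
    then show "x = y" using ker[of "x - y"] by (simp add: L_closed \<phi>.diff)
  qed
  obtain \<psi> where range: "range \<psi> \<subseteq> L" and lin': "Vector_Spaces.linear smult scale \<psi>"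
    and \<psi>: "\<And>x. x \<in> L \<Longrightarrow> \<psi> (\<phi> x) = x"
    using P.linear_exists_left_inverse_on[OF lin subspace_L inj] by blast
  interpret \<psi>: Vector_Spaces.linear smult scale \<psi> by (rule lin')
  have L[simp]: "\<psi> p \<in> L" for p using range by blast
  define br where "br p q = \<phi> (bracket (\<psi> p) (\<psi> q))" for p q
  interpret A: lie_algebra_on smult UNIV br
    by unfold_locales
      (auto simp: br_def \<psi> bracket_closed \<phi>.add \<phi>.scale \<psi>.add \<psi>.scale bracket_add_left bracket_add_right
        bracket_scale_left bracket_scale_right bracket_self jacobi simp flip: \<phi>.add)
  interpret A: poly_lie_algebra br ..
  have br: "\<phi> (bracket x y) = br (\<phi> x) (\<phi> y)" if "x \<in> L" "y \<in> L" for x y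
    using that by (simp add: br_def \<psi>)
  interpret U: lie_algebra_on "scaleE :: 'k \<Rightarrow> _" UNIV commutator
    by (rule E.lie_commutator)
  have "lie_hom_on scale L bracket scaleE UNIV commutator (\<lambda>x. A.rep (\<phi> x))"
    by unfold_locales (simp_all add: \<phi>.add \<phi>.scale A.rep_add A.rep_smult br A.rep_bracket)
  moreover have "inj_on (\<lambda>x. A.rep (\<phi> x)) L"
  proof (rule inj_onI)
    fix x y assume xy: "x \<in> L" "y \<in> L" and eq: "A.rep (\<phi> x) = A.rep (\<phi> y)"
    have "A.rep (\<phi> (x - y)) + A.rep (\<phi> y) = A.rep (\<phi> x)"
      by (simp flip: A.rep_add add: \<phi>.diff)
    then have "\<phi> (x - y) = 0" by (simp add: eq A.rep_eq_0_iff)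
    then show "x = y" using ker[of "x - y"] xy by (simp add: L_closed)
  qed
  ultimately show thesis by (rule that)
qed

theorem theorem4p6:
  fixes scale :: "'k::field \<Rightarrow> 'l::ab_group_add \<Rightarrow> 'l"
    and L :: "'l set" and bracket :: "'l \<Rightarrow> 'l \<Rightarrow> 'l"
  assumes "countable (UNIV :: 'k set)"
    and "lie_algebra_on scale L bracket"
    and "lie_algebra_on.countably_generated scale L bracket"
  shows "\<exists>(M :: 'k poly set) (bracket' :: 'k poly \<Rightarrow> 'k poly \<Rightarrow> 'k poly).
    lie_algebra_on smult M bracket' \<and>
    lie_algebra_on.simple smult M bracket' \<and>
    (\<exists>a b. lie_algebra_on.generated_by smult M bracket' {a, b}) \<and>
    (\<exists>f. lie_hom_on scale L bracket smult M bracket' f \<and> inj_on f L)"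
proof -
  interpret L: lie_algebra_on scale L bracket by (rule assms(2))
  obtain G where G: "countable G" "L.generated_by G"
    using assms(3) by (auto simp: L.countably_generated_def)
  then have "G \<subseteq> L" "L.lie_subalgebra hull G = L"
    unfolding L.generated_by_def by blast+
  then have "countable L"
    using L.countable_hull[OF assms(1) G(1)] by metis
  then obtain \<theta> :: "'l \<Rightarrow> 'k endo" where
    "lie_hom_on scale L bracket scaleE UNIV commutator \<theta>" and \<theta>_inj: "inj_on \<theta> L"
    by (rule L.faithful_representation)
  then interpret \<theta>: lie_hom_on scale L bracket scaleE UNIV commutator \<theta> by simp
  have \<theta>_0: "\<theta> x = 0 \<longleftrightarrow> x = 0" if "x \<in> L" for x
    using inj_onD[OF \<theta>_inj, of x 0] that by (auto simp: \<theta>.hom_0 L.L_closed)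
  have "\<forall>x\<in>L - {0}. \<exists>p q. p * hat (\<theta> x) * q = 1"
    using \<theta>_0 by (metis DiffE hat_full singletonI)
  then obtain p q where pq: "\<And>x. x \<in> L \<Longrightarrow> x \<noteq> 0 \<Longrightarrow> p x * hat (\<theta> x) * q x = 1"
    by (metis DiffI singletonD)
  \<comment> \<open>\<open>C\<close> has to contain the witnesses \<open>p\<close>, \<open>q\<close>
    for \<open>E12_1_in_ideal\<close> and both factors of the commutators in
    \<open>hat_is_commutator\<close>.\<close>
  define Y where "Y = {dt_op, t_op} \<union> (\<lambda>x. t_op * hat (\<theta> x)) ` L \<union> p ` L \<union> q ` L"
  have "countable Y" unfolding Y_def using \<open>countable L\<close> by simp
  then obtain f g :: "'k endo" and a b k where
    gens: "matrix_generators scaleE f g inj_op proj_op a b"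
    and k: "k \<in> E.C f g" "k * f = 1" and Y: "Y \<subseteq> E.C f g"
    by (rule countable_in_two_letter_algebra)
  interpret G: matrix_generators scaleE f g inj_op proj_op a b by (rule gens)
  define S where "S = \<theta>.cod.lie_subalgebra hull {G.gen1, G.gen2}"
  have S_sub: "\<theta>.cod.lie_subalgebra S" unfolding S_def by (rule \<theta>.cod.lie_subalgebra_hull) simp
  interpret S: simple_cover scaleE f g inj_op proj_op a b S k dt_op t_op
  proof
    show "E.subspace S" "\<And>x y. x \<in> S \<Longrightarrow> y \<in> S \<Longrightarrow> commutator x y \<in> S"
      using S_sub by (auto simp: \<theta>.cod.lie_subalgebra_def)
    show "G.gen1 \<in> S" "G.gen2 \<in> S" unfolding S_def by (auto intro: hull_inc)
    show "k \<in> E.C f g" "k * f = 1" by (rule k)+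
    show "dt_op \<in> E.C f g" "t_op \<in> E.C f g" using Y by (auto simp: Y_def)
    show "commutator dt_op t_op = (1 :: 'k endo)" by (rule dt_t)
  qed
  interpret SL: lie_algebra_on scaleE S commutator
    by (rule \<theta>.cod.lie_algebra_on_subalgebra) (rule S_sub)
  have S_gen: "SL.generated_by {G.gen1, G.gen2}"
  proof -
    \<comment> \<open>Transfers generation from the algebra of all operators to \<open>S\<close> as
      its own ambient algebra.\<close>
    have "SL.lie_subalgebra T \<longleftrightarrow> \<theta>.cod.lie_subalgebra T \<and> T \<subseteq> S" for T
      by (auto simp: SL.lie_subalgebra_def \<theta>.cod.lie_subalgebra_def)
    then have "S \<subseteq> SL.lie_subalgebra hull {G.gen1, G.gen2}"
      unfolding hull_def S_def by auto
    moreover have "SL.lie_subalgebra hull {G.gen1, G.gen2} \<subseteq> S"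
      using S.S_gens by (intro hull_minimal SL.lie_subalgebra_L) auto
    ultimately show ?thesis using S.S_gens unfolding SL.generated_by_def by blast
  qed
  have "countable S" unfolding S_def by (rule \<theta>.cod.countable_hull) (auto simp: assms(1))
  have eS: "G.E 1 2 1 \<in> S" by (rule S.E12_in_S) (rule E.C_1)
  have e0: "G.E 1 2 1 \<noteq> 0" by (simp add: G.E_eq_0_iff)
  obtain I where I: "SL.lie_ideal I" "G.E 1 2 1 \<notin> I"
    and max: "\<And>J. SL.lie_ideal J \<Longrightarrow> I \<subseteq> J \<Longrightarrow> G.E 1 2 1 \<notin> J \<Longrightarrow> J = I"
    using SL.maximal_ideal_avoiding[OF e0] by metis
  note I' = SL.lie_ideal_closed[OF I(1)]
  \<comment> \<open>An ideal containing \<open>E 1 2 1\<close> contains both generators, so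
    \<open>I\<close> is maximal among all proper ideals.\<close>
  have max': "J = I \<or> J = S" if J: "SL.lie_ideal J" "I \<subseteq> J" for J
  proof (cases "G.E 1 2 1 \<in> J")
    case True
    note J' = SL.lie_ideal_closed[OF J(1)]
    have "G.gen1 \<in> J" "G.gen2 \<in> J" using S.generators_in_ideal[of J] J' True by auto
    moreover have "SL.lie_subalgebra J" using J' by (auto simp: SL.lie_subalgebra_def)
    ultimately have "SL.lie_subalgebra hull {G.gen1, G.gen2} \<subseteq> J" by (intro hull_minimal) auto
    then show ?thesis using S_gen J'(2) unfolding SL.generated_by_def by blast
  qed (use max J in blast)
  obtain M bracket' \<phi> where hom: "lie_hom_on scaleE S commutator smult M bracket' \<phi>"
    and surj: "\<phi> ` S = M" and ker: "\<And>x. x \<in> S \<Longrightarrow> \<phi> x = 0 \<longleftrightarrow> x \<in> I"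
    using SL.quotient_exists[OF \<open>countable S\<close> I(1)] by metis
  interpret \<phi>: lie_hom_on scaleE S commutator smult M bracket' \<phi> by (rule hom)
  \<comment> \<open>A bracket outside \<open>I\<close>, so that the quotient is not abelian.\<close>
  have "commutator G.gen1 (G.E 1 2 1) = G.E 1 2 1"
    by (simp add: commutator_def G.gen1_def G.E_mult)
  then have simple: "\<phi>.cod.simple"
    using \<phi>.image_simple[OF surj ker max' S.S_gens(1) eS] I(2) I'(2) by simp
  have gen: "\<phi>.cod.generated_by {\<phi> G.gen1, \<phi> G.gen2}"
    using \<phi>.image_generated_by[OF surj S_gen] by simp
  define h where "h x = G.E 1 1 (hat (\<theta> x))" for x
  have h_S: "h x \<in> S" if "x \<in> L" for x
  proof -
    have "dt_op \<in> E.C f g" "t_op * hat (\<theta> x) \<in> E.C f g"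
      using that Y by (auto simp: Y_def)
    from S.E11_commutator_in_S[OF this] show ?thesis
      by (simp only: hat_is_commutator h_def)
  qed
  have h_add: "h (x + y) = h x + h y" if "x \<in> L" "y \<in> L" for x y
    using that by (simp add: h_def \<theta>.hom_add hat_add G.E_add)
  have h_scale: "h (scale c x) = scaleE c (h x)" if "x \<in> L" for c x
    using that by (simp add: h_def \<theta>.hom_scale hat_scale G.E_scale)
  have h_bracket: "h (bracket x y) = commutator (h x) (h y)" if "x \<in> L" "y \<in> L" for x y
    using that by (simp add: h_def \<theta>.hom_bracket hat_commutator G.E_commutator)
  have "lie_hom_on scale L bracket smult M bracket' (\<lambda>x. \<phi> (h x))"
    by unfold_locales
      (simp_all add: h_S h_add h_scale h_bracket \<phi>.hom_closed \<phi>.hom_add \<phi>.hom_scale \<phi>.hom_bracket)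
  moreover have "inj_on (\<lambda>x. \<phi> (h x)) L"
  proof (rule inj_onI, rule ccontr)
    fix x y assume xy: "x \<in> L" "y \<in> L" "\<phi> (h x) = \<phi> (h y)" "x \<noteq> y"
    define z where "z = x - y"
    have z: "z \<in> L" "z \<noteq> 0" "x = y + z" using xy by (auto simp: z_def L.L_closed)
    then have "\<phi> (h y) + \<phi> (h z) = \<phi> (h y)"
      using xy by (simp add: h_add h_S \<phi>.hom_add)
    \<comment> \<open>A nonzero \<open>z\<close> killed by the quotient map would force
      \<open>E 1 2 1\<close> into \<open>I\<close>.\<close>
    then have "h z \<in> I" using ker[OF h_S] z by simp
    then have "G.E 1 1 (hat (\<theta> z)) \<in> I" by (simp only: h_def)
    moreover have "p z \<in> E.C f g" "q z \<in> E.C f g" using Y z by (auto simp: Y_def)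
    ultimately have "G.E 1 2 1 \<in> I"
      using I' pq[OF z(1,2)] by (intro S.E12_1_in_ideal[of I "hat (\<theta> z)" "p z" "q z"]) auto
    then show False using I(2) by simp
  qed
  ultimately show ?thesis
    using \<phi>.cod.lie_algebra_on_axioms simple gen by blast
qed

end
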